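(* Let $W=W_{Z|X,Y}$ be a two-user discrete memoryless multiple access channel (MAC) with finite input alphabets $\mathcal{X}$ (user $\mathsf{A}$) and $\mathcal{Y}$ (user $\mathsf{B}$) and finite output alphabet $\mathcal{Z}$. (1) If $W$ is $\mathsf{A}$-spoofable, then communication with adversary identification from user $\mathsf{A}$ is impossible: specifically, every $(N_{\mathsf{A}},N_{\mathsf{B}},n)$ deterministic adversary identifying code for $W$ with $N_{\mathsf{A}}\ge 2$ has average probability of error $P_e\ge 1/12$. Likewise, if $W$ is $\mathsf{B}$-spoofable, then every $(N_{\mathsf{A}},N_{\mathsf{B}},n)$ deterministic adversary identifying code for $W$ with $N_{\mathsf{B}}\ge 2$ has $P_e\ge 1/12$. (2) If $W$ is neither $\mathsf{A}$-spoofable nor $\mathsf{B}$-spoofable, then the capacity region $\mathcal{C}$ of communication with adversary identification of $W$ has non-empty interior, $\mathsf{int}(\mathcal{C})\neq\emptyset$.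
   Context: **Codes.** An $(N_{\mathsf{A}},N_{\mathsf{B}},n)$ deterministic adversary identifying code consists of message sets $\mathcal{M}_i=\{1,\dots,N_i\}$, $i\in\{\mathsf{A},\mathsf{B}\}$, deterministic encoders $f_{\mathsf{A}}:\mathcal{M}_{\mathsf{A}}\to\mathcal{X}^n$, $f_{\mathsf{B}}:\mathcal{M}_{\mathsf{B}}\to\mathcal{Y}^n$, and a deterministic decoder $\phi:\mathcal{Z}^n\to(\mathcal{M}_{\mathsf{A}}\times\mathcal{M}_{\mathsf{B}})\cup\{\mathbf{a},\mathbf{b}\}$, where the output symbol $\mathbf{a}$ (resp. $\mathbf{b}$) declares user $\mathsf{A}$ (resp. $\mathsf{B}$) to be adversarial. $W^n$ is the $n$-fold product channel. **Error probability.** $P_{e,\mathrm{hon}}=\frac{1}{N_{\mathsf{A}}N_{\mathsf{B}}}\sum_{m_{\mathsf{A}},m_{\mathsf{B}}}W^n(\{z:\phi(z)\ne(m_{\mathsf{A}},m_{\mathsf{B}})\}\mid f_{\mathsf{A}}(m_{\mathsf{A}}),f_{\mathsf{B}}(m_{\mathsf{B}}))$; $P_{e,\mathrm{mal}\,\mathsf{A}}=\max_{x\in\mathcal{X}^n}\frac{1}{N_{\mathsf{B}}}\sum_{m_{\mathsf{B}}}W^n(\{z:\phi(z)\notin(\mathcal{M}_{\mathsf{A}}\times\{m_{\mathsf{B}}\})\cup\{\mathbf{a}\}\}\mid x,f_{\mathsf{B}}(m_{\mathsf{B}}))$; $P_{e,\mathrm{mal}\,\mathsf{B}}=\max_{y\in\mathcal{Y}^n}\frac{1}{N_{\mathsf{A}}}\sum_{m_{\mathsf{A}}}W^n(\{z:\phi(z)\notin(\{m_{\mathsf{A}}\}\times\mathcal{M}_{\mathsf{B}})\cup\{\mathbf{b}\}\}\mid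 f_{\mathsf{A}}(m_{\mathsf{A}}),y)$. The average probability of error is $P_e=\max\{P_{e,\mathrm{hon}},P_{e,\mathrm{mal}\,\mathsf{A}},P_{e,\mathrm{mal}\,\mathsf{B}}\}$. **Capacity region.** $(R_{\mathsf{A}},R_{\mathsf{B}})$ (nonnegative reals) is achievable if there is a sequence of $(\lfloor 2^{nR_{\mathsf{A}}}\rfloor,\lfloor 2^{nR_{\mathsf{B}}}\rfloor,n)$ adversary identifying codes, $n=1,2,\dots$, with $P_e\to0$. $\mathcal{C}\subseteq\mathbb{R}^2$ is the closure of the set of achievable pairs; $\mathsf{int}$ denotes interior in $\mathbb{R}^2$. **Spoofability.** $W$ is $\mathsf{A}$-spoofable if there exist conditional distributions $Q_{Y|\tilde X,\tilde Y}$ (from $\mathcal{X}\times\mathcal{Y}$ to $\mathcal{Y}$) and $Q_{X|\tilde X,X'}$ (from $\mathcal{X}\times\mathcal{X}$ to $\mathcal{X}$) such that for all $x',\tilde x\in\mathcal{X}$, $\tilde y\in\mathcal{Y}$, $z\in\mathcal{Z}$, $$\sum_{y}Q_{Y|\tilde X,\tilde Y}(y|\tilde x,\tilde y)W(z|x',y)=\sum_{y}Q_{Y|\tilde X,\tilde Y}(y|x',\tilde y)W(z|\tilde x,y)=\sum_{x}Q_{X|\tilde X,X'}(x|\tilde x,x')W(z|x,\tilde y).$$ $W$ is $\mathsf{B}$-spoofable if there exist conditional distributions $Q_{X|\tilde X,\tilde Y}$ (from $\mathcal{X}\times\mathcal{Y}$ to $\mathcal{X}$) and $Q_{Y|\tilde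 Y,Y'}$ (from $\mathcal{Y}\times\mathcal{Y}$ to $\mathcal{Y}$) such that for all $\tilde x\in\mathcal{X}$, $\tilde y,y'\in\mathcal{Y}$, $z\in\mathcal{Z}$, $$\sum_{x}Q_{X|\tilde X,\tilde Y}(x|\tilde x,\tilde y)W(z|x,y')=\sum_{x}Q_{X|\tilde X,\tilde Y}(x|\tilde x,y')W(z|x,\tilde y)=\sum_{y}Q_{Y|\tilde Y,Y'}(y|\tilde y,y')W(z|\tilde x,y).$$ *)

theory Defs
  imports "HOL-Probability.Probability" "HOL-Probability.Product_PMF"
begin

(* The alphabets are finite types; a MAC is a stochastic map to output distributions,
   W(z|x,y) = pmf (W x y) z. *)
type_synonym ('x, 'y, 'z) mac = "'x \<Rightarrow> 'y \<Rightarrow> 'z pmf"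

(* Words of length n are functions on {..<n}, extended by the fixed value undefined. *)
definition words :: "nat \<Rightarrow> (nat \<Rightarrow> 'a) set" where
  "words n = ({..<n} \<rightarrow>\<^sub>E UNIV)"

(* With default value undefined, the n-fold product is supported on words n. *)
definition product_channel ::
    "('x, 'y, 'z) mac \<Rightarrow> nat \<Rightarrow> (nat \<Rightarrow> 'x) \<Rightarrow> (nat \<Rightarrow> 'y) \<Rightarrow> (nat \<Rightarrow> 'z) pmf" where
  "product_channel W n x y = Pi_pmf {..<n} undefined (\<lambda>i. W (x i) (y i))"

(* Adversary_A and Adversary_B are the output symbols a and b. *)
datatype verdict = Messages nat nat | Adversary_A | Adversary_B

record ('x, 'y, 'z) code =
  enc_A :: "nat \<Rightarrow> nat \<Rightarrow> 'x"
  enc_B :: "nat \<Rightarrow> nat \<Rightarrow> 'y"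
  dec :: "(nat \<Rightarrow> 'z) \<Rightarrow> verdict"

definition adversary_identifying_code ::
    "nat \<Rightarrow> nat \<Rightarrow> nat \<Rightarrow> ('x, 'y, 'z) code \<Rightarrow> bool" where
  "adversary_identifying_code NA NB n c \<longleftrightarrow>
     NA \<ge> 1 \<and> NB \<ge> 1 \<and> n \<ge> 1 \<and>
     enc_A c \<in> {1..NA} \<rightarrow> words n \<and>
     enc_B c \<in> {1..NB} \<rightarrow> words n \<and>
     dec c \<in> words n \<rightarrow>
       {Messages mA mB | mA mB. mA \<in> {1..NA} \<and> mB \<in> {1..NB}} \<union> {Adversary_A, Adversary_B}"

definition Pe_hon ::
    "('x, 'y, 'z) mac \<Rightarrow> nat \<Rightarrow> nat \<Rightarrow> nat \<Rightarrow> ('x, 'y, 'z) code \<Rightarrow> real" where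
  "Pe_hon W NA NB n c =
     1 / (real NA * real NB) *
     (\<Sum>mA\<in>{1..NA}. \<Sum>mB\<in>{1..NB}.
        measure_pmf.prob (product_channel W n (enc_A c mA) (enc_B c mB))
          {z. dec c z \<noteq> Messages mA mB})"

definition Pe_mal_A ::
    "('x, 'y, 'z) mac \<Rightarrow> nat \<Rightarrow> nat \<Rightarrow> nat \<Rightarrow> ('x, 'y, 'z) code \<Rightarrow> real" where
  "Pe_mal_A W NA NB n c =
     Max ((\<lambda>x. 1 / real NB *
       (\<Sum>mB\<in>{1..NB}.
          measure_pmf.prob (product_channel W n x (enc_B c mB))
            {z. dec c z \<notin> {Messages mA mB | mA. mA \<in> {1..NA}} \<union> {Adversary_A}})) ` words n)"

definition Pe_mal_B ::
    "('x, 'y, 'z) mac \<Rightarrow> nat \<Rightarrow> nat \<Rightarrow> nat \<Rightarrow> ('x, 'y, 'z) code \<Rightarrow> real" where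
  "Pe_mal_B W NA NB n c =
     Max ((\<lambda>y. 1 / real NA *
       (\<Sum>mA\<in>{1..NA}.
          measure_pmf.prob (product_channel W n (enc_A c mA) y)
            {z. dec c z \<notin> {Messages mA mB | mB. mB \<in> {1..NB}} \<union> {Adversary_B}})) ` words n)"

definition Pe ::
    "('x, 'y, 'z) mac \<Rightarrow> nat \<Rightarrow> nat \<Rightarrow> nat \<Rightarrow> ('x, 'y, 'z) code \<Rightarrow> real" where
  "Pe W NA NB n c = Max {Pe_hon W NA NB n c, Pe_mal_A W NA NB n c, Pe_mal_B W NA NB n c}"

definition num_messages :: "real \<Rightarrow> nat \<Rightarrow> nat" where
  "num_messages R n = nat \<lfloor>2 powr (real n * R)\<rfloor>"

(* Sequences of codes are indexed by n = 1, 2, ...; the entry at 0 is unconstrained. *)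
definition achievable :: "('x, 'y, 'z) mac \<Rightarrow> real \<times> real \<Rightarrow> bool" where
  "achievable W = (\<lambda>(RA, RB). RA \<ge> 0 \<and> RB \<ge> 0 \<and>
     (\<exists>c :: nat \<Rightarrow> ('x, 'y, 'z) code.
        (\<forall>n\<ge>1. adversary_identifying_code (num_messages RA n) (num_messages RB n) n (c n)) \<and>
        (\<lambda>n. Pe W (num_messages RA n) (num_messages RB n) n (c n)) \<longlonglongrightarrow> 0))"

definition capacity_region :: "('x, 'y, 'z) mac \<Rightarrow> (real \<times> real) set" where
  "capacity_region W = closure {R. achievable W R}"

definition A_spoofable :: "('x::finite, 'y::finite, 'z::finite) mac \<Rightarrow> bool" where
  "A_spoofable W \<longleftrightarrow>
     (\<exists>(QY :: 'x \<Rightarrow> 'y \<Rightarrow> 'y pmf) (QX :: 'x \<Rightarrow> 'x \<Rightarrow> 'x pmf). \<forall>x' xt yt z.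
        (\<Sum>y\<in>UNIV. pmf (QY xt yt) y * pmf (W x' y) z) =
        (\<Sum>y\<in>UNIV. pmf (QY x' yt) y * pmf (W xt y) z) \<and>
        (\<Sum>y\<in>UNIV. pmf (QY x' yt) y * pmf (W xt y) z) =
        (\<Sum>x\<in>UNIV. pmf (QX xt x') x * pmf (W x yt) z))"

definition B_spoofable :: "('x::finite, 'y::finite, 'z::finite) mac \<Rightarrow> bool" where
  "B_spoofable W \<longleftrightarrow>
     (\<exists>(QX :: 'x \<Rightarrow> 'y \<Rightarrow> 'x pmf) (QY :: 'y \<Rightarrow> 'y \<Rightarrow> 'y pmf). \<forall>xt yt y' z.
        (\<Sum>x\<in>UNIV. pmf (QX xt yt) x * pmf (W x y') z) =
        (\<Sum>x\<in>UNIV. pmf (QX xt y') x * pmf (W x yt) z) \<and>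
        (\<Sum>x\<in>UNIV. pmf (QX xt y') x * pmf (W x yt) z) =
        (\<Sum>y\<in>UNIV. pmf (QY yt y') y * pmf (W xt y) z))"

end

theory Submission
  imports Defs
begin

text \<open>Converse: if \<^term>\<open>W\<close> is A-spoofable, then for two distinct messages of A and one of B there is
  a single output law that arises when B attacks either A-message and also when A attacks the
  B-message. No verdict is correct in all three cases, so the three error probabilities add up
  to at least 1; averaging over the messages gives \<open>P\<^sub>e \<ge> 1/6\<close>.

  Achievability: take random uniform codebooks of small positive rates. A message of A is a
  candidate for the output \<open>z\<close> if some word \<open>y\<close> explains \<open>z\<close> so that, jointly with
  any three other codewords, the letter counts are those of a codeword independent of the rest
  and of an output generated from the codeword and \<open>y\<close> alone. The true message of an honest
  user is a candidate with high probability. By non-spoofability and compactness two candidates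
  of one user never coexist with a candidate of the other, so a user without candidates can be
  declared adversarial and otherwise the pair of candidates is unique.\<close>

section \<open>Exchange of the users\<close>

text \<open>The obstacle to achievability is that the adversary chooses its word knowing the
  codebooks, so fixed codebooks must work for all of the exponentially many words at once. One
  codeword fails to look independent of its side information with probability about exp(-c n) for a
  small c, too much for a plain union bound over the words. Averaging over messages opens a way out:
  as the number of messages grows, a constant number of bad messages per word costs nothing in the
  limit. Many bad messages force k independent rare events, of joint probability about exp(-c k n),
  which beats the number of words for a large constant k; small rates pay for the choice of the
  tuples. The other codewords in the candidate test serve separation: they make the empirical law of
  two A-codewords, a B-codeword and the output explainable in three ways, which is spoofing with
  types in place of kernels. In the converse, pairs of equal messages yield no confusion. They are
  at most half of all ordered pairs, so \<open>3 * Pe >= 1/2\<close> remains.\<close>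

lemma finite_words [simp]: "finite (words n :: (nat \<Rightarrow> 'a::finite) set)"
  by (simp add: words_def finite_PiE)

lemma words_nonempty [simp]: "words n \<noteq> {}"
  by (simp add: words_def PiE_eq_empty_iff)

lemma set_Pi_pmf_words: "set_pmf (Pi_pmf {..<n} undefined p) \<subseteq> words n"
  using set_Pi_pmf_subset[of "{..<n}" undefined p]
  by (auto simp: words_def PiE_def extensional_def)

fun swap_verdict :: "verdict \<Rightarrow> verdict" where
  "swap_verdict (Messages a b) = Messages b a"
| "swap_verdict Adversary_A = Adversary_B"
| "swap_verdict Adversary_B = Adversary_A"

definition swap_code :: "('x, 'y, 'z) code \<Rightarrow> ('y, 'x, 'z) code" where
  "swap_code c = \<lparr>enc_A = enc_B c, enc_B = enc_A c, dec = (\<lambda>z. swap_verdict (dec c z))\<rparr>"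

text \<open>Exchanging the users lets the converse, the separation of candidates and the bound on
  missed candidates be proved for A alone and then be read for B.\<close>

definition swap_mac :: "('x, 'y, 'z) mac \<Rightarrow> ('y, 'x, 'z) mac" where
  "swap_mac W = (\<lambda>y x. W x y)"

lemma swap_code_sel [simp]:
  "enc_A (swap_code c) = enc_B c" "enc_B (swap_code c) = enc_A c"
  "dec (swap_code c) z = swap_verdict (dec c z)"
  by (simp_all add: swap_code_def)

lemma swap_mac_swap_mac [simp]: "swap_mac (swap_mac W) = W"
  by (simp add: swap_mac_def)

lemma product_channel_swap [simp]:
  "product_channel (swap_mac W) n y x = product_channel W n x y"
  by (simp add: product_channel_def swap_mac_def)

lemma swap_verdict_eq_iff [simp]:
  "swap_verdict v = Messages a b \<longleftrightarrow> v = Messages b a"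
  "swap_verdict v = Adversary_A \<longleftrightarrow> v = Adversary_B"
  "swap_verdict v = Adversary_B \<longleftrightarrow> v = Adversary_A"
  by (cases v; auto)+

lemma adversary_identifying_code_swap:
  assumes "adversary_identifying_code NA NB n c"
  shows "adversary_identifying_code NB NA n (swap_code c)"
proof -
  have dec: "dec c z \<in> {Messages mA mB | mA mB. mA \<in> {1..NA} \<and> mB \<in> {1..NB}} \<union> {Adversary_A, Adversary_B}"
    if "z \<in> words n" for z
    using assms that unfolding adversary_identifying_code_def by blast
  have "dec (swap_code c) \<in> words n \<rightarrow>
      {Messages mB mA | mB mA. mB \<in> {1..NB} \<and> mA \<in> {1..NA}} \<union> {Adversary_A, Adversary_B}"
    by (rule Pi_I) (use dec in auto)
  then show ?thesis
    using assms by (simp add: adversary_identifying_code_def)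
qed

lemma Pe_hon_swap: "Pe_hon (swap_mac W) NB NA n (swap_code c) = Pe_hon W NA NB n c"
  unfolding Pe_hon_def by (subst sum.swap) (simp add: mult.commute)

lemma Pe_mal_A_swap: "Pe_mal_A (swap_mac W) NB NA n (swap_code c) = Pe_mal_B W NA NB n c"
  unfolding Pe_mal_A_def Pe_mal_B_def by simp

lemma Pe_mal_B_swap: "Pe_mal_B (swap_mac W) NB NA n (swap_code c) = Pe_mal_A W NA NB n c"
  unfolding Pe_mal_A_def Pe_mal_B_def by simp

lemma Pe_swap: "Pe (swap_mac W) NB NA n (swap_code c) = Pe W NA NB n c"
  unfolding Pe_def by (simp add: Pe_hon_swap Pe_mal_A_swap Pe_mal_B_swap max.commute)

lemma A_spoofable_swap:
  fixes W :: "('x::finite, 'y::finite, 'z::finite) mac"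
  shows "A_spoofable (swap_mac W) \<longleftrightarrow> B_spoofable W"
  (is "?L \<longleftrightarrow> ?R")
proof
  assume ?L
  then obtain QY QX where
    "\<And>x' xt yt z. (\<Sum>y\<in>UNIV. pmf (QY xt yt) y * pmf (W y x') z) =
        (\<Sum>y\<in>UNIV. pmf (QY x' yt) y * pmf (W y xt) z)" and
    "\<And>x' xt yt z. (\<Sum>y\<in>UNIV. pmf (QY x' yt) y * pmf (W y xt) z) =
        (\<Sum>x\<in>UNIV. pmf (QX xt x') x * pmf (W yt x) z)"
    unfolding A_spoofable_def swap_mac_def by blast
  \<comment> \<open>The mixed kernel takes its A-letter first in both definitions, so its arguments
    must be flipped.\<close>
  then show ?R unfolding B_spoofable_def
    by (intro exI[of _ "\<lambda>a b. QY b a"] exI[of _ QX] allI conjI) assumption+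
next
  assume ?R
  then obtain QX QY where
    "\<And>xt yt y' z. (\<Sum>x\<in>UNIV. pmf (QX xt yt) x * pmf (W x y') z) =
        (\<Sum>x\<in>UNIV. pmf (QX xt y') x * pmf (W x yt) z)" and
    "\<And>xt yt y' z. (\<Sum>x\<in>UNIV. pmf (QX xt y') x * pmf (W x yt) z) =
        (\<Sum>y\<in>UNIV. pmf (QY yt y') y * pmf (W xt y) z)"
    unfolding B_spoofable_def by blast
  then show ?L unfolding A_spoofable_def swap_mac_def
    by (intro exI[of _ "\<lambda>a b. QX b a"] exI[of _ QY] allI conjI) assumption+
qed

section \<open>Spoofable channels\<close>

lemma Pe_bounds:
  "Pe_hon W NA NB n c \<le> Pe W NA NB n c"
  "Pe_mal_A W NA NB n c \<le> Pe W NA NB n c"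
  "Pe_mal_B W NA NB n c \<le> Pe W NA NB n c"
  unfolding Pe_def by auto

lemma measure_bind_pmf_eq_expectation:
  "measure_pmf.prob (bind_pmf q P) S = measure_pmf.expectation q (\<lambda>y. measure_pmf.prob (P y) S)"
proof -
  have "ennreal (measure_pmf.prob (bind_pmf q P) S) = (\<integral>\<^sup>+y. ennreal (measure_pmf.prob (P y) S) \<partial>q)"
    unfolding measure_pmf.emeasure_eq_measure[symmetric] by (rule emeasure_bind_pmf)
  also have "\<dots> = ennreal (measure_pmf.expectation q (\<lambda>y. measure_pmf.prob (P y) S))"
    by (rule nn_integral_eq_integral) (auto intro!: measure_pmf.integrable_const_bound[where B=1])
  finally show ?thesis
    by (subst (asm) ennreal_inj) (auto intro!: integral_nonneg_AE)
qed

lemma measure_bind_pmf_eq_sum: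
  assumes "set_pmf q \<subseteq> A" "finite A"
  shows "measure_pmf.prob (bind_pmf q P) S = (\<Sum>y\<in>A. pmf q y * measure_pmf.prob (P y) S)"
proof -
  have "measure_pmf.prob (bind_pmf q P) S = measure_pmf.expectation q (\<lambda>y. measure_pmf.prob (P y) S)"
    by (rule measure_bind_pmf_eq_expectation)
  also have "\<dots> = (\<Sum>y\<in>A. pmf q y * measure_pmf.prob (P y) S)"
    using assms by (subst integral_measure_pmf[of A]) auto
  finally show ?thesis .
qed

text \<open>The error is a maximum over deterministic words only. A letterwise random attack is a
  mixture of such words, because \<open>Pi_pmf\<close> commutes with \<open>bind_pmf\<close>, and an
  average is at most the maximum.\<close>

lemma randomized_attack_le_Pe_mal_B:
  fixes W :: "('x::finite, 'y::finite, 'z::finite) mac" and Q :: "nat \<Rightarrow> 'y pmf"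
  shows "1 / real NA * (\<Sum>mA\<in>{1..NA}. measure_pmf.prob
           (Pi_pmf {..<n} undefined (\<lambda>i. bind_pmf (Q i) (W (enc_A c mA i))))
           {z. dec c z \<notin> {Messages mA mB | mB. mB \<in> {1..NB}} \<union> {Adversary_B}}) \<le> Pe_mal_B W NA NB n c"
    (is "?l * (\<Sum>mA\<in>_. measure_pmf.prob _ (?S mA)) \<le> _")
proof -
  define q where "q = Pi_pmf {..<n} undefined Q"
  have q: "set_pmf q \<subseteq> words n"
    unfolding q_def by (rule set_Pi_pmf_words)
  have eq: "Pi_pmf {..<n} undefined (\<lambda>i. bind_pmf (Q i) (W (x i))) = bind_pmf q (\<lambda>y. product_channel W n x y)" for x
    unfolding q_def product_channel_def by (rule Pi_pmf_bind) simp
  have "?l * (\<Sum>mA\<in>{1..NA}. measure_pmf.prob (bind_pmf q (\<lambda>y. product_channel W n (enc_A c mA) y)) (?S mA))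
      = (\<Sum>y\<in>words n. pmf q y * (?l * (\<Sum>mA\<in>{1..NA}. measure_pmf.prob (product_channel W n (enc_A c mA) y) (?S mA))))"
    by (subst measure_bind_pmf_eq_sum[OF q], simp, subst sum.swap) (simp add: sum_distrib_left mult_ac)
  also have "\<dots> \<le> (\<Sum>y\<in>words n. pmf q y * Pe_mal_B W NA NB n c)"
    unfolding Pe_mal_B_def by (intro sum_mono mult_left_mono Max_ge) auto
  also have "\<dots> = Pe_mal_B W NA NB n c"
    using sum_pmf_eq_1[OF finite_words q] by (simp flip: sum_distrib_right)
  finally show ?thesis by (simp add: eq)
qed

lemma randomized_attack_le_Pe_mal_A:
  fixes W :: "('x::finite, 'y::finite, 'z::finite) mac" and Q :: "nat \<Rightarrow> 'x pmf"
  shows "1 / real NB * (\<Sum>mB\<in>{1..NB}. measure_pmf.prob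
           (Pi_pmf {..<n} undefined (\<lambda>i. bind_pmf (Q i) (\<lambda>x. W x (enc_B c mB i))))
           {z. dec c z \<notin> {Messages mA mB | mA. mA \<in> {1..NA}} \<union> {Adversary_A}}) \<le> Pe_mal_A W NA NB n c"
  using randomized_attack_le_Pe_mal_B[where W="swap_mac W" and c="swap_code c" and Q=Q and NA=NB and NB=NA and n=n]
  by (simp add: Pe_mal_B_swap) (simp add: swap_mac_def)

lemma pmf_bind_sum:
  fixes P :: "'a::finite pmf"
  shows "pmf (bind_pmf P f) z = (\<Sum>a\<in>UNIV. pmf P a * pmf (f a) z)"
  unfolding pmf_bind by (subst integral_measure_pmf[of UNIV]) auto

lemma bind_pmf_eq_iff_sum:
  fixes P :: "'a::finite pmf" and P' :: "'b::finite pmf"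
  shows "bind_pmf P f = bind_pmf P' f' \<longleftrightarrow> (\<forall>z. (\<Sum>a\<in>UNIV. pmf P a * pmf (f a) z) = (\<Sum>a\<in>UNIV. pmf P' a * pmf (f' a) z))"
  by (simp add: pmf_eq_iff pmf_bind_sum)

lemma A_spoofable_imp_Pe_ge:
  fixes W :: "('x::finite, 'y::finite, 'z::finite) mac" and c :: "('x, 'y, 'z) code"
  assumes sp: "A_spoofable W" and code: "adversary_identifying_code NA NB n c" and NA: "NA \<ge> 2"
  shows "Pe W NA NB n c \<ge> 1 / 6"
proof -
  obtain QY QX where Q:
    "\<And>x' xt yt z. (\<Sum>y\<in>UNIV. pmf (QY xt yt) y * pmf (W x' y) z) =
        (\<Sum>y\<in>UNIV. pmf (QY x' yt) y * pmf (W xt y) z)"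
    "\<And>x' xt yt z. (\<Sum>y\<in>UNIV. pmf (QY x' yt) y * pmf (W xt y) z) =
        (\<Sum>x\<in>UNIV. pmf (QX xt x') x * pmf (W x yt) z)"
    using sp unfolding A_spoofable_def by blast
  have Q1: "bind_pmf (QY xt yt) (W x') = bind_pmf (QY x' yt) (W xt)" for x' xt yt
    unfolding bind_pmf_eq_iff_sum using Q(1) by blast
  have Q2: "bind_pmf (QY x' yt) (W xt) = bind_pmf (QX xt x') (\<lambda>x. W x yt)" for x' xt yt
    unfolding bind_pmf_eq_iff_sum using Q(2) by blast
  let ?A = "{1..NA}" and ?B = "{1..NB}"
  define V where "V m m' b = Pi_pmf {..<n} undefined
    (\<lambda>i. bind_pmf (QY (enc_A c m' i) (enc_B c b i)) (W (enc_A c m i)))" for m m' b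
  define SA where "SA m = {z. dec c z \<notin> {Messages m mB | mB. mB \<in> ?B} \<union> {Adversary_B}}" for m
  define SB where "SB m = {z. dec c z \<notin> {Messages mA m | mA. mA \<in> ?A} \<union> {Adversary_A}}" for m
  define e where "e m m' b = measure_pmf.prob (V m m' b) (SA m)" for m m' b
  define g where "g m m' b = measure_pmf.prob (V m m' b) (SB b)" for m m' b
  have V_sym: "V m m' b = V m' m b" for m m' b
    unfolding V_def using Q1 by simp
  have V_A: "V m m' b = Pi_pmf {..<n} undefined
      (\<lambda>i. bind_pmf (QX (enc_A c m i) (enc_A c m' i)) (\<lambda>x. W x (enc_B c b i)))" for m m' b
    using Q2 V_sym unfolding V_def by simp
  have NB: "NB \<ge> 1" using code by (simp add: adversary_identifying_code_def)
  let ?P = "Pe W NA NB n c"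
  have e: "(\<Sum>m\<in>?A. e m m' b) \<le> NA * ?P" for m' b
  proof -
    have "1 / real NA * (\<Sum>m\<in>?A. e m m' b) \<le> Pe_mal_B W NA NB n c"
      unfolding e_def V_def SA_def by (rule randomized_attack_le_Pe_mal_B)
    also have "\<dots> \<le> ?P" by (rule Pe_bounds)
    finally show ?thesis using NA by (simp add: field_simps)
  qed
  have g: "(\<Sum>b\<in>?B. g m m' b) \<le> NB * ?P" for m m'
  proof -
    have "1 / real NB * (\<Sum>b\<in>?B. g m m' b) \<le> Pe_mal_A W NA NB n c"
      unfolding g_def V_A SB_def by (rule randomized_attack_le_Pe_mal_A)
    also have "\<dots> \<le> ?P" by (rule Pe_bounds)
    finally show ?thesis using NB by (simp add: field_simps)
  qed
  have *: "(if m = m' then 0 else 1) \<le> e m m' b + e m' m b + g m m' b" for m m' b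
  proof (cases "m = m'")
    case True
    then show ?thesis by (simp add: e_def g_def)
  next
    case False
    \<comment> \<open>The three sets are the failures. Outside \<open>SA m\<close> and
      \<open>SA m'\<close> only \<open>Adversary_B\<close> is left, and that verdict fails when B is
      the honest user, so it lies in \<open>SB b\<close>.\<close>
    then have "SA m \<union> SA m' \<union> SB b = UNIV"
      by (auto simp: SA_def SB_def)
    then have "1 = measure_pmf.prob (V m m' b) (SA m \<union> SA m' \<union> SB b)" by simp
    also have "\<dots> \<le> e m m' b + e m' m b + g m m' b"
      unfolding e_def g_def V_sym[of m' m]
      by (intro order.trans[OF measure_Un_le] add_mono) auto
    finally show ?thesis using False by simp
  qed
  have "real NA * (real NA - 1) * NB = (\<Sum>m\<in>?A. \<Sum>m'\<in>?A. \<Sum>b\<in>?B. if m = m' then 0 else (1::real))"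
  proof -
    have "(\<Sum>m'\<in>?A. \<Sum>b\<in>?B. if m = m' then 0 else (1::real)) = (real NA - 1) * NB" if "m \<in> ?A" for m
    proof -
      have "(\<Sum>m'\<in>?A. \<Sum>b\<in>?B. if m = m' then 0 else (1::real)) = (\<Sum>m'\<in>?A - {m}. real NB)"
        by (rule sum.mono_neutral_cong_right) auto
      also have "\<dots> = (real NA - 1) * NB"
        using that by (simp add: of_nat_diff)
      finally show ?thesis .
    qed
    then show ?thesis by simp
  qed
  also have "\<dots> \<le> (\<Sum>m\<in>?A. \<Sum>m'\<in>?A. \<Sum>b\<in>?B. e m m' b + e m' m b + g m m' b)"
    by (intro sum_mono *)
  \<comment> \<open>The bound on \<open>e\<close> averages over the honest message of A at a fixed
    guess, so that message is moved innermost; the two \<open>e\<close> terms then have equal sums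
    by symmetry of the index range.\<close>
  also have "\<dots> = 2 * (\<Sum>m'\<in>?A. \<Sum>b\<in>?B. \<Sum>m\<in>?A. e m m' b) + (\<Sum>m\<in>?A. \<Sum>m'\<in>?A. \<Sum>b\<in>?B. g m m' b)"
  proof -
    have 1: "(\<Sum>m\<in>?A. \<Sum>m'\<in>?A. \<Sum>b\<in>?B. e m' m b) = (\<Sum>m'\<in>?A. \<Sum>b\<in>?B. \<Sum>m\<in>?A. e m m' b)"
      by (intro sum.cong refl sum.swap)
    have 2: "(\<Sum>m\<in>?A. \<Sum>m'\<in>?A. \<Sum>b\<in>?B. e m m' b) = (\<Sum>m\<in>?A. \<Sum>m'\<in>?A. \<Sum>b\<in>?B. e m' m b)"
      by (rule sum.swap)
    show ?thesis using 1 2 by (simp add: sum.distrib)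
  qed
  also have "\<dots> \<le> 2 * (\<Sum>m'\<in>?A. \<Sum>b\<in>?B. NA * ?P) + (\<Sum>m\<in>?A. \<Sum>m'\<in>?A. NB * ?P)"
    by (intro add_mono mult_left_mono sum_mono e g) auto
  also have "\<dots> = (real NA * NB) * (3 * NA * ?P)"
    by (simp add: algebra_simps)
  finally have "(real NA * NB) * (real NA - 1) \<le> (real NA * NB) * (3 * NA * ?P)"
    by (simp add: mult_ac)
  then have "real NA - 1 \<le> 3 * NA * ?P"
    using NA NB by (subst (asm) mult_le_cancel_left_pos) auto
  \<comment> \<open>The fraction of pairs of distinct messages is \<open>(NA - 1) / NA\<close>,
    which is at least 1/2 because \<open>NA >= 2\<close>.\<close>
  moreover have "real NA / 2 \<le> real NA - 1" using NA by simp
  ultimately have "real NA * (1 / 2) \<le> real NA * (3 * ?P)" by (simp only: mult.assoc mult.left_commute[of "real NA"])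
  then have "1 / 2 \<le> 3 * ?P"
    using NA by (subst (asm) mult_le_cancel_left_pos) auto
  then show ?thesis by simp
qed

lemma B_spoofable_imp_Pe_ge:
  fixes W :: "('x::finite, 'y::finite, 'z::finite) mac" and c :: "('x, 'y, 'z) code"
  assumes "B_spoofable W" "adversary_identifying_code NA NB n c" "NB \<ge> 2"
  shows "Pe W NA NB n c \<ge> 1 / 6"
  using A_spoofable_imp_Pe_ge[of "swap_mac W" NB NA n "swap_code c"] assms
  by (simp add: A_spoofable_swap Pe_swap adversary_identifying_code_swap)

section \<open>Letter counts and their concentration\<close>

definition cnt :: "nat \<Rightarrow> (nat \<Rightarrow> bool) \<Rightarrow> real" where
  "cnt n P = real (card {i. i < n \<and> P i})"

lemma cnt_nonneg [simp]: "0 \<le> cnt n P"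
  by (simp add: cnt_def)

lemma cnt_conv_sum: "cnt n P = (\<Sum>i<n. of_bool (P i))"
  unfolding cnt_def by (subst sum_of_bool_eq) (auto intro!: arg_cong[of _ _ card])

text \<open>Marginals of counts along an arbitrary map: a constant \<open>h\<close> sums a
  coordinate out, a projection forgets part of it.\<close>

lemma cnt_partition_image:
  fixes s :: "nat \<Rightarrow> 's::finite"
  shows "(\<Sum>v | h v = t. cnt n (\<lambda>i. s i = v \<and> P i)) = cnt n (\<lambda>i. h (s i) = t \<and> P i)"
proof -
  have "(\<Sum>v | h v = t. cnt n (\<lambda>i. s i = v \<and> P i)) = (\<Sum>i<n. \<Sum>v | h v = t. of_bool (s i = v \<and> P i))"
    unfolding cnt_conv_sum by (rule sum.swap)
  also have "\<dots> = (\<Sum>i<n. of_bool (h (s i) = t \<and> P i))"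
  proof (intro sum.cong refl)
    fix i
    have "(\<Sum>v | h v = t. of_bool (s i = v \<and> P i)) = (\<Sum>v | h v = t. if v = s i then of_bool (P i) else (0::real))"
      by (intro sum.cong) auto
    also have "\<dots> = of_bool (h (s i) = t \<and> P i)" by (simp add: sum.delta)
    finally show "(\<Sum>v | h v = t. of_bool (s i = v \<and> P i)) = (of_bool (h (s i) = t \<and> P i) :: real)" .
  qed
  finally show ?thesis by (simp add: cnt_conv_sum)
qed

text \<open>Hoeffding's inequality for the indicators at the selected positions. The tolerance is
  measured against \<open>n\<close> and not against the number of selected positions, so the
  exponent is the same for every \<open>Q\<close>.\<close>

lemma Pi_pmf_count_concentration:
  fixes p :: "nat \<Rightarrow> 'a pmf"
  assumes t: "t > 0"
  shows "measure_pmf.prob (Pi_pmf {..<n} d p)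
           {f. \<bar>cnt n (\<lambda>i. Q i \<and> f i \<in> B i) - (\<Sum>i | i < n \<and> Q i. measure_pmf.prob (p i) (B i))\<bar> > t * n}
         \<le> 2 * exp (-2 * t\<^sup>2 * n)"
proof (cases "{i. i < n \<and> Q i} = {}")
  \<comment> \<open>With no position selected, Hoeffding's bound would have denominator 0; count and
    mean are then both 0.\<close>
  case True
  then have *: "cnt n (\<lambda>i. Q i \<and> f i \<in> B i) = 0" for f
    by (auto simp: cnt_def)
  have "\<not> t * n < 0" using t by (simp add: not_less)
  then show ?thesis by (simp only: True * sum.empty) simp
next
  case False
  define I where "I = {i. i < n \<and> Q i}"
  have I: "I \<subseteq> {..<n}" "finite I" "I \<noteq> {}" using False by (auto simp: I_def)
  let ?M = "measure_pmf (Pi_pmf {..<n} d p)"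
  define X where "X i f = (indicator (B i) (f i) :: real)" for i f
  have indep: "prob_space.indep_vars ?M (\<lambda>_. borel) X I"
    unfolding X_def
    by (rule prob_space.indep_vars_compose2[OF _ prob_space.indep_vars_subset[OF _ indep_vars_Pi_pmf I(1)]])
       (auto simp: measure_pmf.prob_space_axioms)
  have expX: "measure_pmf.expectation (Pi_pmf {..<n} d p) (X i) = measure_pmf.prob (p i) (B i)"
    if "i \<in> I" for i
  proof -
    have "measure_pmf.expectation (Pi_pmf {..<n} d p) (X i) =
      measure_pmf.expectation (map_pmf (\<lambda>f. f i) (Pi_pmf {..<n} d p)) (indicator (B i))"
      unfolding integral_map_pmf X_def ..
    also have "\<dots> = measure_pmf.prob (p i) (B i)"
      using that I by (subst Pi_pmf_component) auto
    finally show ?thesis .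
  qed
  interpret H: Hoeffding_ineq ?M I X "\<lambda>_. 0" "\<lambda>_. 1" "\<Sum>i\<in>I. measure_pmf.expectation (Pi_pmf {..<n} d p) (X i)"
    by unfold_locales (use I indep in \<open>auto simp: X_def indicator_def\<close>)
  have "card I > 0" using I by (simp add: card_gt_0_iff)
  have "card I \<le> n" using card_mono[OF _ I(1)] by simp
  have cnt: "cnt n (\<lambda>i. Q i \<and> f i \<in> B i) = (\<Sum>i\<in>I. X i f)" for f
  proof -
    have "(\<Sum>i\<in>I. X i f) = real (card {i\<in>I. f i \<in> B i})"
      unfolding X_def using I(2) by (simp add: indicator_def sum_of_bool_eq flip: of_bool_def)
         (auto intro!: arg_cong[of _ _ card])
    also have "{i\<in>I. f i \<in> B i} = {i. i < n \<and> Q i \<and> f i \<in> B i}" by (auto simp: I_def)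
    finally show ?thesis by (simp add: cnt_def)
  qed
  have "measure_pmf.prob (Pi_pmf {..<n} d p) {f. \<bar>cnt n (\<lambda>i. Q i \<and> f i \<in> B i) - (\<Sum>i\<in>I. measure_pmf.prob (p i) (B i))\<bar> > t * n}
    \<le> measure_pmf.prob (Pi_pmf {..<n} d p) {f \<in> space ?M. \<bar>(\<Sum>i\<in>I. X i f) - (\<Sum>i\<in>I. measure_pmf.expectation (Pi_pmf {..<n} d p) (X i))\<bar> \<ge> t * n}"
    by (intro measure_pmf.finite_measure_mono) (auto simp: cnt expX)
  also have "\<dots> \<le> 2 * exp (-2 * (t * n)\<^sup>2 / (\<Sum>i\<in>I. (1 - 0)\<^sup>2))"
    using t \<open>card I > 0\<close> by (intro H.Hoeffding_ineq_abs_ge) auto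
  also have "\<dots> = 2 * exp (- (2 * (t * n)\<^sup>2 / card I))" by simp
  also have "\<dots> \<le> 2 * exp (- (2 * (t * n)\<^sup>2 / n))"
    using \<open>card I > 0\<close> \<open>card I \<le> n\<close> by (intro mult_left_mono iffD2[OF exp_le_cancel_iff] le_imp_neg_le divide_left_mono) auto
  also have "2 * (t * n)\<^sup>2 / n = 2 * t\<^sup>2 * n"
    by (simp add: power2_eq_square)
  finally show ?thesis by (simp add: I_def)
qed

text \<open>The empirical form of \<open>x\<close> being uniform and independent of
  \<open>s\<close>.\<close>

definition near_indep :: "real \<Rightarrow> nat \<Rightarrow> (nat \<Rightarrow> 'a::finite) \<Rightarrow> (nat \<Rightarrow> 's) \<Rightarrow> bool" where
  "near_indep \<epsilon> n x s \<longleftrightarrow>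
     (\<forall>a v. \<bar>cnt n (\<lambda>i. s i = v \<and> x i = a) - cnt n (\<lambda>i. s i = v) / CARD('a)\<bar> \<le> \<epsilon> * n)"

text \<open>The empirical form of three facts: \<open>x\<close> is uniform, it is independent of
  (\<open>y\<close>, \<open>s\<close>), and \<open>z\<close> comes from \<open>W\<close> given
  (\<open>x\<close>, \<open>y\<close>) without further influence of \<open>s\<close>. The counts of
  (\<open>y\<close>, \<open>s\<close>) are left free, since an adversary may shape them.\<close>

definition typical :: "('x::finite, 'y, 'z) mac \<Rightarrow> real \<Rightarrow> nat \<Rightarrow>
    (nat \<Rightarrow> 'x) \<Rightarrow> (nat \<Rightarrow> 'y) \<Rightarrow> (nat \<Rightarrow> 's) \<Rightarrow> (nat \<Rightarrow> 'z) \<Rightarrow> bool" where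
  "typical W \<epsilon> n x y s z \<longleftrightarrow>
     (\<forall>a b v e. \<bar>cnt n (\<lambda>i. x i = a \<and> y i = b \<and> s i = v \<and> z i = e)
        - pmf (W a b) e / CARD('x) * cnt n (\<lambda>i. y i = b \<and> s i = v)\<bar> \<le> \<epsilon> * n)"

definition random_word :: "nat \<Rightarrow> (nat \<Rightarrow> 'a::finite) pmf" where
  "random_word n = Pi_pmf {..<n} undefined (\<lambda>_. pmf_of_set UNIV)"

lemma measure_ex_le:
  fixes M :: "'a pmf" and P :: "'i::finite \<Rightarrow> 'a \<Rightarrow> bool"
  assumes "\<And>i. measure_pmf.prob M {x. P i x} \<le> B"
  shows "measure_pmf.prob M {x. \<exists>i. P i x} \<le> real CARD('i) * B"
proof -
  have "{x. \<exists>i. P i x} = (\<Union>i\<in>UNIV. {x. P i x})" by auto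
  also have "measure_pmf.prob M \<dots> \<le> (\<Sum>i\<in>UNIV. measure_pmf.prob M {x. P i x})"
    by (rule measure_pmf.finite_measure_subadditive_finite) auto
  also have "\<dots> \<le> (\<Sum>i\<in>(UNIV::'i set). B)" by (intro sum_mono assms)
  finally show ?thesis by simp
qed

lemma prob_not_near_indep_le:
  fixes s :: "nat \<Rightarrow> 's::finite"
  assumes "\<epsilon> > 0"
  shows "measure_pmf.prob (random_word n) {x :: nat \<Rightarrow> 'a::finite. \<not> near_indep \<epsilon> n x s}
    \<le> real CARD('a \<times> 's) * (2 * exp (-2 * \<epsilon>\<^sup>2 * n))"
proof -
  let ?P = "\<lambda>(a, v) x. \<bar>cnt n (\<lambda>i. s i = v \<and> x i = (a::'a)) - cnt n (\<lambda>i. s i = v) / CARD('a)\<bar> > \<epsilon> * n"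
  have "{x :: nat \<Rightarrow> 'a. \<not> near_indep \<epsilon> n x s} = {x. \<exists>av. ?P av x}"
    by (auto simp: near_indep_def not_le)
  also have "measure_pmf.prob (random_word n) \<dots> \<le> real CARD('a \<times> 's) * (2 * exp (-2 * \<epsilon>\<^sup>2 * n))"
  proof (rule measure_ex_le)
    fix av :: "'a \<times> 's"
    obtain a v where av: "av = (a, v)" by (cases av)
    have "(\<Sum>i | i < n \<and> s i = v. measure_pmf.prob (pmf_of_set UNIV) {a}) = cnt n (\<lambda>i. s i = v) / CARD('a)"
      by (simp add: cnt_def measure_pmf_of_set)
    then show "measure_pmf.prob (random_word n) {x. ?P av x} \<le> 2 * exp (-2 * \<epsilon>\<^sup>2 * n)"
      using Pi_pmf_count_concentration[OF assms, of n undefined "\<lambda>_. pmf_of_set UNIV" "\<lambda>i. s i = v" "\<lambda>_. {a}"]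
      by (simp add: random_word_def av)
  qed
  finally show ?thesis .
qed

text \<open>Half of the tolerance goes to the codeword and half to the noise: concentration ties the
  counts with \<open>z\<close> to those of (\<open>x\<close>, \<open>y\<close>, \<open>s\<close>),
  and near independence ties the latter to the counts of (\<open>y\<close>,
  \<open>s\<close>).\<close>

lemma prob_not_typical_le:
  fixes W :: "('x::finite, 'y::finite, 'z::finite) mac" and s :: "nat \<Rightarrow> 's::finite"
  assumes "\<epsilon> > 0" and ni: "near_indep (\<epsilon> / 2) n x (\<lambda>i. (y i, s i))"
  shows "measure_pmf.prob (product_channel W n x y) {z. \<not> typical W \<epsilon> n x y s z}
    \<le> real CARD('x \<times> 'y \<times> 's \<times> 'z) * (2 * exp (- (\<epsilon>\<^sup>2 / 2 * n)))"
proof -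
  let ?c = "\<lambda>a b v. cnt n (\<lambda>i. x i = a \<and> y i = b \<and> s i = v)"
  let ?P = "\<lambda>(a, b, v, e) z. \<bar>cnt n (\<lambda>i. (x i = a \<and> y i = b \<and> s i = v) \<and> z i \<in> {e}) - pmf (W a b) e * ?c a b v\<bar> > \<epsilon> / 2 * n"
  have ni': "\<bar>?c a b v - cnt n (\<lambda>i. y i = b \<and> s i = v) / CARD('x)\<bar> \<le> \<epsilon> / 2 * n" for a b v
    using ni[unfolded near_indep_def, rule_format, of "(b, v)" a] by (simp add: conj_ac)
  have "{z. \<not> typical W \<epsilon> n x y s z} \<subseteq> {z. \<exists>i. ?P i z}"
  proof (clarify, rule ccontr)
    fix z assume nt: "\<not> typical W \<epsilon> n x y s z" and "\<nexists>i. ?P i z"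
    then have *: "\<bar>cnt n (\<lambda>i. (x i = a \<and> y i = b \<and> s i = v) \<and> z i \<in> {e}) - pmf (W a b) e * ?c a b v\<bar> \<le> \<epsilon> / 2 * n" for a b v e
      by (auto simp: not_less)
    have "\<bar>cnt n (\<lambda>i. x i = a \<and> y i = b \<and> s i = v \<and> z i = e)
        - pmf (W a b) e / CARD('x) * cnt n (\<lambda>i. y i = b \<and> s i = v)\<bar> \<le> \<epsilon> * n" for a b v e
    proof -
      have triangle: "\<bar>C - B\<bar> \<le> 2 * r" if "\<bar>C - A\<bar> \<le> r" "\<bar>A - B\<bar> \<le> r" for A B C r :: real
        using that by linarith
      have "\<bar>pmf (W a b) e * (?c a b v - cnt n (\<lambda>i. y i = b \<and> s i = v) / CARD('x))\<bar> \<le> 1 * (\<epsilon> / 2 * n)"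
        unfolding abs_mult by (intro mult_mono ni') (auto simp: pmf_le_1)
      then have "\<bar>pmf (W a b) e * ?c a b v - pmf (W a b) e / CARD('x) * cnt n (\<lambda>i. y i = b \<and> s i = v)\<bar> \<le> \<epsilon> / 2 * n"
        by (simp add: right_diff_distrib)
      from triangle[OF *[of a b v e] this] show ?thesis by simp
    qed
    with nt show False unfolding typical_def by blast
  qed
  then have "measure_pmf.prob (product_channel W n x y) {z. \<not> typical W \<epsilon> n x y s z}
     \<le> measure_pmf.prob (product_channel W n x y) {z. \<exists>i. ?P i z}"
    by (intro measure_pmf.finite_measure_mono) auto
  also have "\<dots> \<le> real CARD('x \<times> 'y \<times> 's \<times> 'z) * (2 * exp (- (\<epsilon>\<^sup>2 / 2 * n)))"
  proof (rule measure_ex_le)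
    fix i :: "'x \<times> 'y \<times> 's \<times> 'z"
    obtain a b v e where i: "i = (a, b, v, e)" by (cases i)
    have "(\<Sum>i | i < n \<and> x i = a \<and> y i = b \<and> s i = v. measure_pmf.prob (W (x i) (y i)) {e}) = pmf (W a b) e * ?c a b v"
      by (simp add: cnt_def measure_pmf_single)
    moreover have "2 * exp (- 2 * (\<epsilon> / 2)\<^sup>2 * real n) = 2 * exp (- (\<epsilon>\<^sup>2 / 2 * n))"
      by (simp add: power2_eq_square)
    ultimately show "measure_pmf.prob (product_channel W n x y) {z. ?P i z} \<le> 2 * exp (- (\<epsilon>\<^sup>2 / 2 * n))"
      using Pi_pmf_count_concentration[of "\<epsilon> / 2" n undefined "\<lambda>i. W (x i) (y i)" "\<lambda>i. x i = a \<and> y i = b \<and> s i = v" "\<lambda>_. {e}"]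
        assms(1) by (simp only: product_channel_def prod.case i)
  qed
  finally show ?thesis .
qed

section \<open>Separation of candidates\<close>

lemma ex_pmf_eq:
  fixes f :: "'a::finite \<Rightarrow> real"
  assumes "\<And>a. 0 \<le> f a" "(\<Sum>a\<in>UNIV. f a) = 1"
  shows "\<exists>p. \<forall>a. pmf p a = f a"
proof (intro exI allI)
  show "pmf (embed_pmf f) a = f a" for a
    using assms by (intro pmf_embed_pmf) (auto simp: nn_integral_count_space_finite sum_ennreal)
qed

text \<open>Equality of the three laws forces the conditioning pairs to be uniform, so conditional
  distributions exist; symmetrising them in the two codewords of A then makes the first two
  attacks use the same kernel.\<close>

lemma A_spoofable_if_equal_joint_laws:
  fixes W :: "('x::finite, 'y::finite, 'z::finite) mac"
    and q1 q2 :: "'y \<times> 'x \<times> 'y \<Rightarrow> real" and q3 :: "'x \<times> 'x \<times> 'x \<Rightarrow> real"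
  assumes q: "\<And>i. q1 i \<ge> 0" "\<And>i. q2 i \<ge> 0" "\<And>i. q3 i \<ge> 0"
    and q1: "sum q1 UNIV = 1"
    and eq12: "\<And>x' xt yt z. 1 / CARD('x) * (\<Sum>y\<in>UNIV. q1 (y, xt, yt) * pmf (W x' y) z) =
       1 / CARD('x) * (\<Sum>y\<in>UNIV. q2 (y, x', yt) * pmf (W xt y) z)"
    and eq13: "\<And>x' xt yt z. 1 / CARD('x) * (\<Sum>y\<in>UNIV. q1 (y, xt, yt) * pmf (W x' y) z) =
       1 / CARD('y) * (\<Sum>x\<in>UNIV. q3 (x, xt, x') * pmf (W x yt) z)"
  shows "A_spoofable W"
proof -
  let ?X = "real CARD('x)" and ?Y = "real CARD('y)"
  define F where "F x' xt yt z = (\<Sum>y\<in>UNIV. q1 (y, xt, yt) * pmf (W x' y) z)" for x' xt yt z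
  have F2: "(\<Sum>y\<in>UNIV. q2 (y, x', yt) * pmf (W xt y) z) = F x' xt yt z" for x' xt yt z
    using eq12[of xt yt x' z] by (simp add: F_def)
  have F3: "(\<Sum>x\<in>UNIV. q3 (x, xt, x') * pmf (W x yt) z) = ?Y / ?X * F x' xt yt z" for x' xt yt z
    using eq13[of xt yt x' z] by (simp add: F_def field_simps)
  have sumW: "(\<Sum>z\<in>UNIV. pmf (W x y) z) = 1" for x y
    by (rule sum_pmf_eq_1) auto
  define m where "m xt yt = (\<Sum>y\<in>UNIV. q1 (y, xt, yt))" for xt yt
  have m1: "(\<Sum>z\<in>UNIV. F x' xt yt z) = m xt yt" for x' xt yt
    unfolding F_def m_def by (subst sum.swap) (simp flip: sum_distrib_left add: sumW)
  have m2: "(\<Sum>z\<in>UNIV. F x' xt yt z) = (\<Sum>y\<in>UNIV. q2 (y, x', yt))" for x' xt yt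
    unfolding F2[symmetric] by (subst sum.swap) (simp flip: sum_distrib_left add: sumW)
  have m3: "(\<Sum>z\<in>UNIV. ?Y / ?X * F x' xt yt z) = (\<Sum>x\<in>UNIV. q3 (x, xt, x'))" for x' xt yt
    unfolding F3[symmetric] by (subst sum.swap) (simp flip: sum_distrib_left add: sumW)
  have m3': "?Y / ?X * m xt yt = (\<Sum>x\<in>UNIV. q3 (x, xt, x'))" for x' xt yt
    unfolding m3[symmetric, of _ _ yt] sum_distrib_left[symmetric] m1 ..
  \<comment> \<open>Summing over the output leaves the mass of a conditioning pair. Read through
    \<open>q1\<close> it depends on (\<open>xt\<close>, \<open>yt\<close>), through
    \<open>q2\<close> on (\<open>x'\<close>, \<open>yt\<close>), through \<open>q3\<close> on
    (\<open>xt\<close>, \<open>x'\<close>). The first two readings remove \<open>xt\<close> and the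
    third removes \<open>yt\<close>, so the mass is constant.\<close>
  define \<kappa> where "\<kappa> = m undefined undefined"
  have m: "m xt yt = \<kappa>" for xt yt
  proof -
    have "m xt yt = m undefined yt" using m1 m2 by metis
    also have "?Y / ?X * m undefined yt = ?Y / ?X * \<kappa>" unfolding \<kappa>_def m3'[where x'=undefined] ..
    then have "m undefined yt = \<kappa>" by simp
    finally show ?thesis .
  qed
  have "(\<Sum>xy\<in>UNIV. \<Sum>y\<in>UNIV. q1 (y, xy)) = 1"
    using q1 by (subst sum.swap) (simp add: sum.cartesian_product UNIV_Times_UNIV)
  then have "(\<Sum>xy\<in>(UNIV :: ('x \<times> 'y) set). \<kappa>) = 1"
    by (simp add: m[unfolded m_def] split_paired_all case_prod_beta cong: sum.cong_simp)
  then have "real CARD('x \<times> 'y) * \<kappa> = 1" by (simp del: card_prod)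
  then have "\<kappa> > 0"
    by (metis zero_less_one of_nat_0_le_iff zero_less_mult_pos order_less_le mult_zero_left)
  have "\<exists>p. \<forall>y. pmf p y = (q1 (y, xt, yt) + q2 (y, xt, yt)) / (2 * \<kappa>)" for xt yt
  proof (rule ex_pmf_eq)
    show "0 \<le> (q1 (a, xt, yt) + q2 (a, xt, yt)) / (2 * \<kappa>)" for a
      using q \<open>\<kappa> > 0\<close> by simp
    have "(\<Sum>y\<in>UNIV. q2 (y, xt, yt)) = \<kappa>" using m1 m2 m by metis
    then show "(\<Sum>a\<in>UNIV. (q1 (a, xt, yt) + q2 (a, xt, yt)) / (2 * \<kappa>)) = 1"
      using m[of xt yt] \<open>\<kappa> > 0\<close> by (simp add: m_def sum.distrib flip: sum_divide_distrib)
  qed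
  then obtain QY where QY: "\<And>xt yt y. pmf (QY xt yt) y = (q1 (y, xt, yt) + q2 (y, xt, yt)) / (2 * \<kappa>)"
    by metis
  define \<kappa>3 where "\<kappa>3 = ?Y / ?X * \<kappa>"
  have "\<kappa>3 > 0" using \<open>\<kappa> > 0\<close> by (simp add: \<kappa>3_def)
  have \<kappa>3: "(\<Sum>x\<in>UNIV. q3 (x, xt, x')) = \<kappa>3" for xt x'
    using m3'[of xt undefined x'] by (simp add: m \<kappa>3_def)
  have "\<exists>p. \<forall>x. pmf p x = (q3 (x, xt, x') + q3 (x, x', xt)) / (2 * \<kappa>3)" for xt x'
  proof (rule ex_pmf_eq)
    show "0 \<le> (q3 (x, xt, x') + q3 (x, x', xt)) / (2 * \<kappa>3)" for x
      using q \<open>\<kappa>3 > 0\<close> by simp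
    show "(\<Sum>x\<in>UNIV. (q3 (x, xt, x') + q3 (x, x', xt)) / (2 * \<kappa>3)) = 1"
      using \<open>\<kappa>3 > 0\<close> by (simp add: sum.distrib \<kappa>3 flip: sum_divide_distrib)
  qed
  then obtain QX where QX: "\<And>xt x' x. pmf (QX xt x') x = (q3 (x, xt, x') + q3 (x, x', xt)) / (2 * \<kappa>3)"
    by metis
  \<comment> \<open>The right-hand side is invariant under exchanging \<open>x'\<close> and
    \<open>xt\<close>, which yields the first equality in \<open>A_spoofable\<close>; fact
    \<open>2\<close> has the same right-hand side and yields the second.\<close>
  have 1: "(\<Sum>y\<in>UNIV. pmf (QY xt yt) y * pmf (W x' y) z) = (F x' xt yt z + F xt x' yt z) / (2 * \<kappa>)" for xt yt x' z
    unfolding QY F2[symmetric, of xt x'] by (simp add: F_def sum.distrib distrib_right add_divide_distrib sum_divide_distrib)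
  have 2: "(\<Sum>x\<in>UNIV. pmf (QX xt x') x * pmf (W x yt) z) = (F x' xt yt z + F xt x' yt z) / (2 * \<kappa>)" for xt yt x' z
  proof -
    have "(\<Sum>x\<in>UNIV. pmf (QX xt x') x * pmf (W x yt) z) =
      (?Y / ?X * F x' xt yt z + ?Y / ?X * F xt x' yt z) / (2 * \<kappa>3)"
      unfolding QX F3[symmetric] by (simp only: times_divide_eq_left distrib_right sum.distrib flip: sum_divide_distrib)
    also have "\<dots> = (F x' xt yt z + F xt x' yt z) / (2 * \<kappa>)"
      using \<open>\<kappa> > 0\<close> by (simp add: \<kappa>3_def field_simps)
    finally show ?thesis .
  qed
  show ?thesis unfolding A_spoofable_def
    by (rule exI[of _ QY], rule exI[of _ QX]) (simp add: 1 2 add.commute)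
qed

section \<open>Compactness: from exact to approximate spoofing\<close>

lemma compact_prob_simplex: "compact {v :: real ^ 'i::finite. (\<forall>i. 0 \<le> v $ i) \<and> (\<Sum>i\<in>UNIV. v $ i) = 1}"
  (is "compact ?K")
proof -
  have "?K = (\<Inter>i. {v. 0 \<le> v $ i}) \<inter> {v. (\<Sum>i\<in>UNIV. v $ i) = 1}" by auto
  moreover have "closed \<dots>"
    by (intro closed_Int closed_INT ballI closed_Collect_le closed_Collect_eq continuous_intros)
  ultimately have "closed ?K" by simp
  moreover have "bounded ?K"
  proof (rule boundedI)
    fix v :: "real ^ 'i" assume v: "v \<in> ?K"
    have "norm v \<le> (\<Sum>i\<in>UNIV. \<bar>v $ i\<bar>)" by (rule norm_le_l1_cart)
    also have "\<dots> = 1" using v by simp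
    finally show "norm v \<le> 1" .
  qed
  ultimately show ?thesis by (simp add: compact_eq_bounded_closed)
qed

text \<open>One function \<open>p\<close> explained in three ways up to \<eta>: by A sending
  \<open>x'\<close>, by A sending \<open>xt\<close>, or by B sending \<open>yt\<close>, each time
  uniformly and independently of the attack. The attacks are joint laws rather than kernels, so that
  they range over compact simplices, enter linearly and can be matched with types.\<close>

definition approx_spoofing :: "('x::finite, 'y::finite, 'z::finite) mac \<Rightarrow> real \<Rightarrow>
    ('y \<times> 'x \<times> 'y \<Rightarrow> real) \<Rightarrow> ('y \<times> 'x \<times> 'y \<Rightarrow> real) \<Rightarrow> ('x \<times> 'x \<times> 'x \<Rightarrow> real) \<Rightarrow>
    ('x \<Rightarrow> 'x \<Rightarrow> 'y \<Rightarrow> 'z \<Rightarrow> real) \<Rightarrow> bool" where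
  "approx_spoofing W \<eta> q1 q2 q3 p \<longleftrightarrow>
     (\<forall>i. q1 i \<ge> 0) \<and> (\<forall>i. q2 i \<ge> 0) \<and> (\<forall>i. q3 i \<ge> 0) \<and>
     sum q1 UNIV = 1 \<and> sum q2 UNIV = 1 \<and> sum q3 UNIV = 1 \<and>
     (\<forall>x' xt yt z.
       \<bar>p x' xt yt z - 1 / CARD('x) * (\<Sum>y\<in>UNIV. q1 (y, xt, yt) * pmf (W x' y) z)\<bar> \<le> \<eta> \<and>
       \<bar>p x' xt yt z - 1 / CARD('x) * (\<Sum>y\<in>UNIV. q2 (y, x', yt) * pmf (W xt y) z)\<bar> \<le> \<eta> \<and>
       \<bar>p x' xt yt z - 1 / CARD('y) * (\<Sum>x\<in>UNIV. q3 (x, xt, x') * pmf (W x yt) z)\<bar> \<le> \<eta>)"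

text \<open>The total discrepancy between the three explanations is continuous on a compact set, so
  it attains its minimum; a minimum of 0 would be an exact spoofing.\<close>

lemma nonspoofable_gap:
  fixes W :: "('x::finite, 'y::finite, 'z::finite) mac"
  assumes "\<not> A_spoofable W"
  shows "\<exists>\<eta>>0. \<forall>q1 q2 q3 p. \<not> approx_spoofing W \<eta> q1 q2 q3 p"
proof -
  let ?K1 = "{v :: real ^ ('y \<times> 'x \<times> 'y). (\<forall>i. 0 \<le> v $ i) \<and> (\<Sum>i\<in>UNIV. v $ i) = 1}"
  let ?K3 = "{v :: real ^ ('x \<times> 'x \<times> 'x). (\<forall>i. 0 \<le> v $ i) \<and> (\<Sum>i\<in>UNIV. v $ i) = 1}"
  let ?K = "?K1 \<times> ?K1 \<times> ?K3"
  let ?I = "UNIV :: ('x \<times> 'x \<times> 'y \<times> 'z) set"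
  define F1 where "F1 v = (\<lambda>(x', xt, yt, z). 1 / CARD('x) * (\<Sum>y\<in>UNIV. v $ (y, xt, yt) * pmf (W x' y) z))"
    for v :: "real ^ ('y \<times> 'x \<times> 'y)"
  define F2 where "F2 v = (\<lambda>(x', xt, yt, z). 1 / CARD('x) * (\<Sum>y\<in>UNIV. v $ (y, x', yt) * pmf (W xt y) z))"
    for v :: "real ^ ('y \<times> 'x \<times> 'y)"
  define F3 where "F3 v = (\<lambda>(x', xt, yt, z). 1 / CARD('y) * (\<Sum>x\<in>UNIV. v $ (x, xt, x') * pmf (W x yt) z))"
    for v :: "real ^ ('x \<times> 'x \<times> 'x)"
  define f where "f v = (\<Sum>i\<in>?I. \<bar>F1 (fst v) i - F2 (fst (snd v)) i\<bar> + \<bar>F1 (fst v) i - F3 (snd (snd v)) i\<bar>)" for v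
  have "compact ?K" by (intro compact_Times compact_prob_simplex)
  moreover have "?K \<noteq> {}"
  proof -
    have "(\<chi> i. 1 / CARD('y \<times> 'x \<times> 'y), \<chi> i. 1 / CARD('y \<times> 'x \<times> 'y), \<chi> i. 1 / CARD('x \<times> 'x \<times> 'x)) \<in> ?K"
      by (simp del: card_prod)
    then show ?thesis by (metis empty_iff)
  qed
  moreover have "continuous_on ?K f"
    unfolding f_def F1_def F2_def F3_def case_prod_beta
    by (intro continuous_intros)
  ultimately obtain v where v: "v \<in> ?K" and v_min: "\<And>w. w \<in> ?K \<Longrightarrow> f v \<le> f w"
    using continuous_attains_inf[of ?K f] by blast
  obtain v1 v2 v3 where v_eq: "v = (v1, v2, v3)" by (cases v)
  have "f v \<ge> 0" by (simp add: f_def sum_nonneg)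
  moreover have "f v \<noteq> 0"
  proof
    assume "f v = 0"
    then have *: "\<bar>F1 v1 i - F2 v2 i\<bar> + \<bar>F1 v1 i - F3 v3 i\<bar> = 0" for i
      unfolding f_def v_eq by (subst (asm) sum_nonneg_eq_0_iff) (simp_all del: split_paired_All)
    have "F1 v1 i = F2 v2 i" "F1 v1 i = F3 v3 i" for i using *[of i] by auto
    then have "A_spoofable W"
      using v unfolding v_eq F1_def F2_def F3_def
      by (intro A_spoofable_if_equal_joint_laws[of "\<lambda>i. v1 $ i" "\<lambda>i. v2 $ i" "\<lambda>i. v3 $ i"]) (force simp: fun_eq_iff)+
    then show False using assms by simp
  qed
  ultimately have fv: "f v > 0" by simp
  define N where "N = real (card ?I)"
  have "N > 0" by (simp add: N_def)
  \<comment> \<open>Each index compares two pairs of explanations, and each comparison through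
    \<open>p\<close> costs twice the tolerance. That is four tolerances for each of \<open>N\<close>
    indices, in total half of the minimum \<open>f v\<close>.\<close>
  have "\<not> approx_spoofing W (f v / (8 * N)) q1 q2 q3 p" for q1 q2 q3 p
  proof
    assume approx: "approx_spoofing W (f v / (8 * N)) q1 q2 q3 p"
    note q = approx[unfolded approx_spoofing_def]
    note close = approx[unfolded approx_spoofing_def, THEN conjunct2, THEN conjunct2, THEN conjunct2,
        THEN conjunct2, THEN conjunct2, THEN conjunct2, rule_format]
    let ?w = "(\<chi> i. q1 i, \<chi> i. q2 i, \<chi> i. q3 i)"
    have "f v \<le> f ?w" using q by (intro v_min) auto
    also have "\<dots> \<le> (\<Sum>i\<in>?I. 4 * (f v / (8 * N)))"
    proof -
      have bound: "\<bar>F1 (\<chi> i. q1 i) i - F2 (\<chi> i. q2 i) i\<bar> + \<bar>F1 (\<chi> i. q1 i) i - F3 (\<chi> i. q3 i) i\<bar> \<le> 4 * (f v / (8 * N))" for i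
      proof -
        obtain x' xt yt z where i: "i = (x', xt, yt, z)" by (cases i)
        have tri: "\<bar>A - B\<bar> + \<bar>A - C\<bar> \<le> 4 * r" if "\<bar>P - A\<bar> \<le> r" "\<bar>P - B\<bar> \<le> r" "\<bar>P - C\<bar> \<le> r" for A B C P r :: real
          using that by linarith
        show ?thesis
          unfolding i F1_def F2_def F3_def prod.case vec_lambda_beta
          using close[of x' xt yt z] by (intro tri[of "p x' xt yt z"]) blast+
      qed
      show ?thesis unfolding f_def[of ?w] fst_conv snd_conv by (rule sum_mono) (rule bound)
    qed
    also have "\<dots> = f v / 2" using \<open>N > 0\<close> by (simp add: N_def)
    finally show False using fv by simp
  qed
  moreover have "f v / (8 * N) > 0" using fv \<open>N > 0\<close> by simp
  ultimately show ?thesis by blast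
qed

text \<open>The side information has two codewords of the other user so that the same condition serves
  both separations: as an A-candidate it is compared with (A, B), as a B-candidate with (A, A).\<close>

definition cand :: "('x::finite, 'y::finite, 'z::finite) mac \<Rightarrow> real \<Rightarrow> nat \<Rightarrow> nat \<Rightarrow> nat \<Rightarrow>
    (nat \<Rightarrow> nat \<Rightarrow> 'x) \<Rightarrow> (nat \<Rightarrow> nat \<Rightarrow> 'y) \<Rightarrow> (nat \<Rightarrow> 'z) \<Rightarrow> nat set" where
  "cand W \<epsilon> n NA NB cA cB z = {m \<in> {1..NA}. \<exists>y\<in>words n. \<forall>m'\<in>{1..NA} - {m}. \<forall>b\<in>{1..NB}. \<forall>b'\<in>{1..NB}.
     typical W \<epsilon> n (cA m) y (\<lambda>i. (cA m' i, cB b i, cB b' i)) z}"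

text \<open>The unknown letters of \<open>y\<close> are summed out and the side information is
  coarsened by \<open>h\<close>, because each explanation sees a different part of it. Every cell
  contributes one error \<epsilon> n.\<close>

lemma typical_sum:
  fixes W :: "('x::finite, 'y::finite, 'z::finite) mac" and s :: "nat \<Rightarrow> 's::finite"
  assumes "typical W \<epsilon> n x y s z" "0 \<le> \<epsilon>"
  shows "\<bar>cnt n (\<lambda>i. x i = a \<and> h (s i) = t \<and> z i = e)
     - 1 / CARD('x) * (\<Sum>b\<in>UNIV. cnt n (\<lambda>i. y i = b \<and> h (s i) = t) * pmf (W a b) e)\<bar>
     \<le> real CARD('y \<times> 's) * (\<epsilon> * n)"
proof -
  let ?V = "(UNIV :: 'y set) \<times> {v. h v = t}"
  have 1: "cnt n (\<lambda>i. x i = a \<and> h (s i) = t \<and> z i = e) =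
     (\<Sum>(b, v)\<in>?V. cnt n (\<lambda>i. x i = a \<and> y i = b \<and> s i = v \<and> z i = e))"
  proof -
    have "(\<Sum>(b, v)\<in>?V. cnt n (\<lambda>i. x i = a \<and> y i = b \<and> s i = v \<and> z i = e)) =
       (\<Sum>b\<in>UNIV. \<Sum>v | h v = t. cnt n (\<lambda>i. s i = v \<and> (y i = b \<and> x i = a \<and> z i = e)))"
      by (simp add: sum.cartesian_product conj_ac)
    also have "\<dots> = (\<Sum>b\<in>UNIV. cnt n (\<lambda>i. y i = b \<and> (h (s i) = t \<and> x i = a \<and> z i = e)))"
      unfolding cnt_partition_image by (simp add: conj_ac)
    also have "\<dots> = cnt n (\<lambda>i. x i = a \<and> h (s i) = t \<and> z i = e)"
      using cnt_partition_image[where h="\<lambda>_. True" and t=True and n=n and s=y and P="\<lambda>i. h (s i) = t \<and> x i = a \<and> z i = e"]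
      by (simp add: conj_ac)
    finally show ?thesis ..
  qed
  have 2: "1 / CARD('x) * (\<Sum>b\<in>UNIV. cnt n (\<lambda>i. y i = b \<and> h (s i) = t) * pmf (W a b) e) =
     (\<Sum>(b, v)\<in>?V. pmf (W a b) e / CARD('x) * cnt n (\<lambda>i. y i = b \<and> s i = v))"
  proof -
    have "(\<Sum>v | h v = t. cnt n (\<lambda>i. y i = b \<and> s i = v)) = cnt n (\<lambda>i. y i = b \<and> h (s i) = t)" for b
      using cnt_partition_image[where h=h and t=t and n=n and s=s and P="\<lambda>i. y i = b"] by (simp add: conj_ac)
    then have "1 / CARD('x) * (\<Sum>b\<in>UNIV. cnt n (\<lambda>i. y i = b \<and> h (s i) = t) * pmf (W a b) e) =
      (\<Sum>b\<in>UNIV. pmf (W a b) e / CARD('x) * (\<Sum>v | h v = t. cnt n (\<lambda>i. y i = b \<and> s i = v)))"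
      by (simp add: sum_distrib_left mult_ac)
    also have "\<dots> = (\<Sum>(b, v)\<in>?V. pmf (W a b) e / CARD('x) * cnt n (\<lambda>i. y i = b \<and> s i = v))"
      by (simp only: sum_distrib_left sum.cartesian_product)
    finally show ?thesis .
  qed
  have "\<bar>cnt n (\<lambda>i. x i = a \<and> h (s i) = t \<and> z i = e)
     - 1 / CARD('x) * (\<Sum>b\<in>UNIV. cnt n (\<lambda>i. y i = b \<and> h (s i) = t) * pmf (W a b) e)\<bar> =
     \<bar>\<Sum>(b, v)\<in>?V. cnt n (\<lambda>i. x i = a \<and> y i = b \<and> s i = v \<and> z i = e) - pmf (W a b) e / CARD('x) * cnt n (\<lambda>i. y i = b \<and> s i = v)\<bar>"
    unfolding 1 2 by (simp add: case_prod_beta sum_subtractf)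
  also have "\<dots> \<le> (\<Sum>bv\<in>?V. \<bar>case bv of (b, v) \<Rightarrow> cnt n (\<lambda>i. x i = a \<and> y i = b \<and> s i = v \<and> z i = e)
      - pmf (W a b) e / CARD('x) * cnt n (\<lambda>i. y i = b \<and> s i = v)\<bar>)"
    by (rule sum_abs)
  also have "\<dots> \<le> (\<Sum>bv\<in>?V. \<epsilon> * n)"
    by (rule sum_mono) (use assms(1)[unfolded typical_def] in \<open>auto simp only: prod.case\<close>)
  also have "\<dots> \<le> real CARD('y \<times> 's) * (\<epsilon> * n)"
  proof -
    have "card ?V \<le> CARD('y \<times> 's)" by (rule card_mono) auto
    then show ?thesis
      unfolding sum_constant using assms(2) by (intro mult_right_mono) auto
  qed
  finally show ?thesis .
qed

text \<open>If \<open>m1\<close> and \<open>m2\<close> differ and \<open>b\<close> is a B-candidate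
  for the same output, the type of the three codewords and \<open>z\<close> is approximately
  spoofed, with the types of the explaining words as attacks. The gap excludes this, uniformly in
  the block length and the codebooks.\<close>

lemma cand_separation:
  fixes W :: "('x::finite, 'y::finite, 'z::finite) mac"
  assumes "\<not> A_spoofable W"
  obtains \<epsilon>0 where "\<epsilon>0 > 0"
    "\<And>\<epsilon> n NA NB cA cB z m1 m2 b. \<lbrakk>0 \<le> \<epsilon>; \<epsilon> \<le> \<epsilon>0; n \<ge> 1; NB \<ge> 2;
       m1 \<in> cand W \<epsilon> n NA NB cA cB z; m2 \<in> cand W \<epsilon> n NA NB cA cB z;
       b \<in> cand (swap_mac W) \<epsilon> n NB NA cB cA z\<rbrakk> \<Longrightarrow> m1 = m2"
proof -
  obtain \<eta> where \<eta>: "\<eta> > 0" and gap: "\<And>q1 q2 q3 p. \<not> approx_spoofing W \<eta> q1 q2 q3 p"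
    using nonspoofable_gap[OF assms] by blast
  define M1 where "M1 = real CARD('y \<times> ('x \<times> 'y \<times> 'y))"
  define M2 where "M2 = real CARD('x \<times> ('y \<times> 'x \<times> 'x))"
  have M: "M1 > 0" "M2 > 0" unfolding M1_def M2_def by (simp_all del: card_prod add: card_gt_0_iff)
  \<comment> \<open>Summing out multiplies the tolerance by \<open>M1\<close> or by
    \<open>M2\<close>; dividing \<eta> by the sum keeps both results below \<eta>.\<close>
  define \<epsilon>0 where "\<epsilon>0 = \<eta> / (M1 + M2)"
  show thesis
  proof (rule that)
    show "\<epsilon>0 > 0" using \<eta> M by (simp add: \<epsilon>0_def)
  next
    fix \<epsilon> n NA NB cA cB z m1 m2 b
    assume \<epsilon>: "0 \<le> \<epsilon>" "\<epsilon> \<le> \<epsilon>0" and n: "n \<ge> (1::nat)" and NB: "NB \<ge> (2::nat)"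
      and m1: "m1 \<in> cand W \<epsilon> n NA NB cA cB z" and m2: "m2 \<in> cand W \<epsilon> n NA NB cA cB z"
      and b: "b \<in> cand (swap_mac W) \<epsilon> n NB NA cB cA z"
    show "m1 = m2"
    proof (rule ccontr)
      assume neq: "m1 \<noteq> m2"
      have mem: "m1 \<in> {1..NA}" "m2 \<in> {1..NA}" "b \<in> {1..NB}"
        using m1 m2 b by (auto simp: cand_def)
      \<comment> \<open>The test of \<open>b\<close> ranges over the other B-codewords and would be
        vacuous without one, hence \<open>NB >= 2\<close>. The letters of \<open>b''\<close> are
        summed out again in the third comparison.\<close>
      obtain b'' where b'': "b'' \<in> {1..NB} - {b}"
        using NB by (metis Diff_iff One_nat_def Suc_1 atLeastAtMost_iff le_refl le_trans n_not_Suc_n singletonD Suc_leD)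
      obtain y1 where t1: "typical W \<epsilon> n (cA m1) y1 (\<lambda>i. (cA m2 i, cB b i, cB b i)) z"
        using m1 mem neq unfolding cand_def by blast
      obtain y2 where t2: "typical W \<epsilon> n (cA m2) y2 (\<lambda>i. (cA m1 i, cB b i, cB b i)) z"
        using m2 mem neq unfolding cand_def by blast
      obtain x where t3: "typical (swap_mac W) \<epsilon> n (cB b) x (\<lambda>i. (cB b'' i, cA m2 i, cA m1 i)) z"
        using b mem b'' unfolding cand_def by blast
      have eM: "M1 * \<epsilon> \<le> \<eta>" "M2 * \<epsilon> \<le> \<eta>"
      proof -
        have "(M1 + M2) * \<epsilon> \<le> \<eta>" using \<epsilon> M unfolding \<epsilon>0_def by (simp add: field_simps)
        moreover have "0 \<le> M1 * \<epsilon>" "0 \<le> M2 * \<epsilon>" using M \<epsilon> by auto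
        ultimately show "M1 * \<epsilon> \<le> \<eta>" "M2 * \<epsilon> \<le> \<eta>" by (auto simp: distrib_right)
      qed
      have scale: "\<bar>A / n - c * (\<Sum>k\<in>UNIV. B k / n * w k)\<bar> \<le> \<eta>"
        if "\<bar>A - c * (\<Sum>k\<in>UNIV. B k * w k)\<bar> \<le> M * (\<epsilon> * n)" "M * \<epsilon> \<le> \<eta>"
        for A c M :: real and B w :: "'k::finite \<Rightarrow> real"
      proof -
        have "A / n - c * (\<Sum>k\<in>UNIV. B k / n * w k) = (A - c * (\<Sum>k\<in>UNIV. B k * w k)) / n"
          by (simp add: diff_divide_distrib sum_divide_distrib sum_distrib_left)
        moreover have "\<bar>A - c * (\<Sum>k\<in>UNIV. B k * w k)\<bar> \<le> \<eta> * n"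
          using that(1) mult_right_mono[OF that(2), of "real n"] by (simp add: mult.assoc)
        ultimately show ?thesis
          using n by (simp add: pos_divide_le_eq)
      qed
      have prob: "(\<Sum>v\<in>UNIV. cnt n (\<lambda>i. s i = v) / n) = 1" for s :: "nat \<Rightarrow> 'k::finite"
        using cnt_partition_image[where h="\<lambda>_. True" and t=True and n=n and s=s and P="\<lambda>_. True"] n
        by (simp add: cnt_def flip: sum_divide_distrib)
      \<comment> \<open>These are types: of the explaining word with the two codewords regarded as
        independent of the tested one, and for \<open>p\<close> of the three codewords with the
        output.\<close>
      define q1 where "q1 v = cnt n (\<lambda>i. (y1 i, cA m2 i, cB b i) = v) / n" for v
      define q2 where "q2 v = cnt n (\<lambda>i. (y2 i, cA m1 i, cB b i) = v) / n" for v
      define q3 where "q3 v = cnt n (\<lambda>i. (x i, cA m2 i, cA m1 i) = v) / n" for v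
      define p where "p x' xt yt e = cnt n (\<lambda>i. cA m1 i = x' \<and> cA m2 i = xt \<and> cB b i = yt \<and> z i = e) / n" for x' xt yt e
      have "approx_spoofing W \<eta> q1 q2 q3 p" unfolding approx_spoofing_def
      proof (intro conjI allI)
        show "q1 v \<ge> 0" "q2 v \<ge> 0" "q3 u \<ge> 0" for v u by (simp_all add: q1_def q2_def q3_def)
        show "sum q1 UNIV = 1" "sum q2 UNIV = 1" "sum q3 UNIV = 1"
          unfolding q1_def q2_def q3_def by (rule prob)+
        fix x' xt yt e
        show "\<bar>p x' xt yt e - 1 / CARD('x) * (\<Sum>y\<in>UNIV. q1 (y, xt, yt) * pmf (W x' y) e)\<bar> \<le> \<eta>"
          unfolding p_def q1_def
          by (rule scale[OF _ eM(1)])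
             (use typical_sum[OF t1 \<epsilon>(1), of x' "\<lambda>(a, d, d'). (a, d)" "(xt, yt)" e] in \<open>simp add: M1_def conj_ac\<close>)
        show "\<bar>p x' xt yt e - 1 / CARD('x) * (\<Sum>y\<in>UNIV. q2 (y, x', yt) * pmf (W xt y) e)\<bar> \<le> \<eta>"
          unfolding p_def q2_def
          by (rule scale[OF _ eM(1)])
             (use typical_sum[OF t2 \<epsilon>(1), of xt "\<lambda>(a, d, d'). (a, d)" "(x', yt)" e] in \<open>simp add: M1_def conj_ac\<close>)
        show "\<bar>p x' xt yt e - 1 / CARD('y) * (\<Sum>x\<in>UNIV. q3 (x, xt, x') * pmf (W x yt) e)\<bar> \<le> \<eta>"
          unfolding p_def q3_def
          by (rule scale[OF _ eM(2)])
             (use typical_sum[OF t3 \<epsilon>(1), of yt "\<lambda>(d, a, a'). (a, a')" "(xt, x')" e] in \<open>simp add: M2_def conj_ac swap_mac_def\<close>)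
      qed
      with gap show False by blast
    qed
  qed
qed

section \<open>Random codebooks\<close>

lemma ex_large_subset_disjoint_image:
  fixes t :: "'a \<Rightarrow> 'a"
  assumes "finite B" "\<And>m. m \<in> B \<Longrightarrow> t m \<noteq> m"
  shows "\<exists>S\<subseteq>B. card B \<le> 3 * card S \<and> t ` S \<inter> S = {}"
  \<comment> \<open>Greedily keep a vertex of in-degree at most 1 and discard its at most two neighbours.\<close>
  using assms
proof (induction B rule: finite_psubset_induct)
  case (psubset B)
  show ?case
  proof (cases "B = {}")
    case False
    have "\<exists>v\<in>B. card {u\<in>B. t u = v} \<le> 1"
    proof (rule ccontr)
      assume "\<not> ?thesis"
      then have "(\<Sum>v\<in>B. 2) \<le> (\<Sum>v\<in>B. card {u\<in>B. t u = v})"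
        by (intro sum_mono) auto
      also have "\<dots> = card (\<Union>v\<in>B. {u\<in>B. t u = v})"
        using psubset.hyps by (subst card_UN_disjoint) auto
      also have "\<dots> \<le> card B"
        using psubset.hyps by (intro card_mono) auto
      finally show False
        using False psubset.hyps by (simp add: card_gt_0_iff)
    qed
    then obtain v where v: "v \<in> B" "card {u\<in>B. t u = v} \<le> 1" by blast
    define R where "R = {v, t v} \<union> {u\<in>B. t u = v}"
    have "card R \<le> card {v, t v} + card {u\<in>B. t u = v}"
      unfolding R_def by (rule card_Un_le)
    also have "\<dots> \<le> 3"
      using v(2) card_insert_le_m1[of 2 "{t v}" v] by (simp add: card_insert_if split: if_splits)
    finally have R: "card R \<le> 3" .
    have finR: "finite R" using psubset.hyps by (simp add: R_def)
    have "\<exists>S\<subseteq>B - R. card (B - R) \<le> 3 * card S \<and> t ` S \<inter> S = {}"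
      using v psubset.prems by (intro psubset.IH) (auto simp: R_def)
    then obtain S where S: "S \<subseteq> B - R" "card (B - R) \<le> 3 * card S" "t ` S \<inter> S = {}"
      by blast
    have "v \<notin> S" "finite S"
      using S(1) psubset.hyps by (auto simp: R_def intro: finite_subset)
    have "card B \<le> card (B - R) + card R"
      using card_Un_le[of "B - R" R] card_mono[of "(B - R) \<union> R" B] psubset.hyps finR by force
    also have "\<dots> \<le> 3 * card (insert v S)"
      using S(2) R \<open>v \<notin> S\<close> \<open>finite S\<close> by simp
    finally have "card B \<le> 3 * card (insert v S)" .
    moreover have "t ` insert v S \<inter> insert v S = {}"
      using S(1,3) psubset.prems[OF v(1)] by (auto simp: R_def)
    moreover have "insert v S \<subseteq> B" using S(1) v by auto
    ultimately show ?thesis by blast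
  qed simp
qed

text \<open>The messages given up when the adversary sends \<open>y\<close>. For all others the
  codeword looks as if drawn after \<open>y\<close> and the side information were fixed.\<close>

definition bad_messages :: "real \<Rightarrow> nat \<Rightarrow> nat \<Rightarrow> nat \<Rightarrow> (nat \<Rightarrow> nat \<Rightarrow> 'x::finite) \<Rightarrow>
    (nat \<Rightarrow> nat \<Rightarrow> 'y) \<Rightarrow> (nat \<Rightarrow> 'y) \<Rightarrow> nat set" where
  "bad_messages \<epsilon> n NA NB cA cB y = {m \<in> {1..NA}. \<exists>m'\<in>{1..NA} - {m}. \<exists>b\<in>{1..NB}. \<exists>b'\<in>{1..NB}.
     \<not> near_indep \<epsilon> n (cA m) (\<lambda>i. (y i, cA m' i, cB b i, cB b' i))}"

definition bad_tuple :: "real \<Rightarrow> nat \<Rightarrow> (nat \<Rightarrow> nat \<Rightarrow> 'x::finite) \<Rightarrow> (nat \<Rightarrow> nat \<Rightarrow> 'y) \<Rightarrow> (nat \<Rightarrow> 'y) \<Rightarrow>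
    nat \<times> nat \<times> nat \<times> nat \<Rightarrow> bool" where
  "bad_tuple \<epsilon> n cA cB y = (\<lambda>(m, m', b, b').
     \<not> near_indep \<epsilon> n (cA m) (\<lambda>i. (y i, cA m' i, cB b i, cB b' i)))"

definition tuple_families :: "nat \<Rightarrow> nat \<Rightarrow> nat \<Rightarrow> (nat \<Rightarrow> nat \<times> nat \<times> nat \<times> nat) set" where
  "tuple_families k NA NB = {\<sigma> \<in> {..<k} \<rightarrow>\<^sub>E {1..NA} \<times> {1..NA} \<times> {1..NB} \<times> {1..NB}.
     inj_on (\<lambda>j. fst (\<sigma> j)) {..<k} \<and> (\<forall>j<k. \<forall>j'<k. fst (snd (\<sigma> j)) \<noteq> fst (\<sigma> j'))}"

lemma finite_tuple_families [simp]: "finite (tuple_families k NA NB)"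
  unfolding tuple_families_def
  by (rule finite_subset[of _ "{..<k} \<rightarrow>\<^sub>E {1..NA} \<times> {1..NA} \<times> {1..NB} \<times> {1..NB}"])
     (auto intro!: finite_PiE)

lemma card_tuple_families_le: "card (tuple_families k NA NB) \<le> (NA * NA * NB * NB) ^ k"
proof -
  have "card (tuple_families k NA NB) \<le> card ({..<k} \<rightarrow>\<^sub>E {1..NA} \<times> {1..NA} \<times> {1..NB} \<times> {1..NB})"
    unfolding tuple_families_def by (intro card_mono finite_PiE) auto
  also have "\<dots> = (NA * NA * NB * NB) ^ k"
    by (simp add: card_PiE mult.assoc)
  finally show ?thesis .
qed

text \<open>The extracted family has its first components distinct and disjoint from its second
  components, so that the events in it are independent given the remaining codewords.\<close>

lemma many_bad_messages_imp_bad_family: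
  assumes "card (bad_messages \<epsilon> n NA NB cA cB y) \<ge> 3 * k"
  shows "\<exists>\<sigma>\<in>tuple_families k NA NB. \<forall>j<k. bad_tuple \<epsilon> n cA cB y (\<sigma> j)"
proof -
  let ?B = "bad_messages \<epsilon> n NA NB cA cB y"
  have fin: "finite ?B" by (simp add: bad_messages_def)
  have "\<forall>m\<in>?B. \<exists>r. r \<in> ({1..NA} - {m}) \<times> {1..NB} \<times> {1..NB} \<and> bad_tuple \<epsilon> n cA cB y (m, r)"
    unfolding bad_messages_def bad_tuple_def by fastforce
  then obtain r where r: "\<And>m. m \<in> ?B \<Longrightarrow> r m \<in> ({1..NA} - {m}) \<times> {1..NB} \<times> {1..NB} \<and> bad_tuple \<epsilon> n cA cB y (m, r m)"
    by metis
  have "fst (r m) \<noteq> m" if "m \<in> ?B" for m using r[OF that] by (cases "r m") auto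
  then obtain S where S: "S \<subseteq> ?B" "card ?B \<le> 3 * card S" "(\<lambda>m. fst (r m)) ` S \<inter> S = {}"
    using ex_large_subset_disjoint_image[OF fin, of "\<lambda>m. fst (r m)"] by blast
  \<comment> \<open>The factor 3 in the hypothesis pays for discarding messages that serve as side
    information for one another.\<close>
  then have "k \<le> card S" using assms by simp
  then obtain S0 where S0: "S0 \<subseteq> S" "card S0 = k" "finite S0"
    by (metis obtain_subset_with_card_n)
  obtain e where e: "bij_betw e {..<k} S0"
    using ex_bij_betw_nat_finite[OF S0(3)] S0(2) by (auto simp: atLeast0LessThan)
  have eS: "e j \<in> S" if "j < k" for j using e S0(1) that by (auto simp: bij_betw_def)
  define \<sigma> where "\<sigma> = (\<lambda>j\<in>{..<k}. (e j, r (e j)))"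
  have \<sigma>: "\<sigma> j = (e j, r (e j))" if "j < k" for j using that by (simp add: \<sigma>_def)
  have mem: "e j \<in> {1..NA}" "r (e j) \<in> {1..NA} \<times> {1..NB} \<times> {1..NB}" if "j < k" for j
  proof -
    have "e j \<in> ?B" using eS[OF that] S(1) by blast
    then show "e j \<in> {1..NA}" "r (e j) \<in> {1..NA} \<times> {1..NB} \<times> {1..NB}"
      using r[of "e j"] by (simp_all add: bad_messages_def mem_Times_iff)
  qed
  have "\<sigma> \<in> tuple_families k NA NB"
    unfolding tuple_families_def
  proof (intro CollectI conjI allI impI)
    show "\<sigma> \<in> {..<k} \<rightarrow>\<^sub>E {1..NA} \<times> {1..NA} \<times> {1..NB} \<times> {1..NB}"
      using mem by (auto simp: \<sigma>_def)
    show "inj_on (\<lambda>j. fst (\<sigma> j)) {..<k}"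
      using e by (auto simp: bij_betw_def inj_on_def \<sigma>)
    show "fst (snd (\<sigma> j)) \<noteq> fst (\<sigma> j')" if "j < k" "j' < k" for j j'
      using S(3) eS[OF that(1)] eS[OF that(2)] that by (auto simp: \<sigma>)
  qed
  moreover have "bad_tuple \<epsilon> n cA cB y (\<sigma> j)" if "j < k" for j
    using r[of "e j"] eS[OF that] S(1) that by (auto simp: \<sigma>)
  ultimately show ?thesis by blast
qed

definition random_book :: "nat \<Rightarrow> nat \<Rightarrow> (nat \<Rightarrow> nat \<Rightarrow> 'a::finite) pmf" where
  "random_book N n = Pi_pmf {1..N} (\<lambda>_. undefined) (\<lambda>_. random_word n)"

lemma random_book_words:
  assumes "c \<in> set_pmf (random_book N n)" "m \<in> {1..N}"
  shows "c m \<in> words n"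
  using assms set_Pi_pmf_words[of n "\<lambda>_. pmf_of_set UNIV"]
  unfolding random_book_def random_word_def by (fastforce simp: set_Pi_pmf PiE_dflt_def)

lemma measure_bind_pmf_le:
  assumes "\<And>y. measure_pmf.prob (P y) S \<le> B"
  shows "measure_pmf.prob (bind_pmf q P) S \<le> B"
  unfolding measure_bind_pmf_eq_expectation
  by (rule measure_pmf.integral_le_const)
     (auto intro!: measure_pmf.integrable_const_bound[where B=1] assms)

text \<open>The B-book is fixed, and so are the A-codewords outside the first components of
  \<sigma>. The codewords still random are independent and each carries one of the \<open>k\<close>
  events, so the probabilities multiply.\<close>

lemma prob_bad_family_le:
  fixes cB :: "nat \<Rightarrow> nat \<Rightarrow> 'y::finite" and \<epsilon> :: real
  assumes "\<epsilon> > 0" and \<sigma>: "\<sigma> \<in> tuple_families k NA NB"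
  shows "measure_pmf.prob (random_book NA n) {cA :: nat \<Rightarrow> nat \<Rightarrow> 'x::finite. \<forall>j<k. bad_tuple \<epsilon> n cA cB y (\<sigma> j)}
    \<le> (real CARD('x \<times> 'y \<times> 'x \<times> 'y \<times> 'y) * (2 * exp (-2 * \<epsilon>\<^sup>2 * n))) ^ k"
    (is "measure_pmf.prob _ ?E \<le> ?p ^ k")
proof -
  let ?m = "\<lambda>j. fst (\<sigma> j)"
  define S where "S = ?m ` {..<k}"
  define R where "R = {1..NA} - S"
  have inj: "inj_on ?m {..<k}" and disj: "\<And>j. j < k \<Longrightarrow> fst (snd (\<sigma> j)) \<notin> S"
    and S_sub: "S \<subseteq> {1..NA}" and sub: "\<And>j. j < k \<Longrightarrow> fst (snd (\<sigma> j)) \<in> {1..NA}"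
    using \<sigma> by (auto simp: tuple_families_def S_def PiE_iff mem_Times_iff)
  have fin: "finite R" "finite S" "R \<inter> S = {}" and un: "{1..NA} = R \<union> S"
    using S_sub by (auto simp: R_def S_def)
  have cardS: "card S = k" unfolding S_def using inj by (simp add: card_image)
  define inv where "inv = the_inv_into {..<k} ?m"
  have inv: "inv (?m j) = j" if "j < k" for j
    unfolding inv_def using that by (intro the_inv_into_f_eq[OF inj]) auto
  let ?PR = "Pi_pmf R (\<lambda>_. undefined) (\<lambda>_. random_word n) :: (nat \<Rightarrow> nat \<Rightarrow> 'x) pmf"
  let ?PS = "Pi_pmf S (\<lambda>_. undefined) (\<lambda>_. random_word n) :: (nat \<Rightarrow> nat \<Rightarrow> 'x) pmf"
  let ?join = "\<lambda>g f x. if x \<in> R then g x else f x"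
  have "random_book NA n = bind_pmf ?PR (\<lambda>g. map_pmf (?join g) ?PS)"
    unfolding random_book_def un
    by (subst Pi_pmf_union[OF fin])
       (simp add: pair_pmf_def map_bind_pmf map_pmf_def bind_assoc_pmf bind_return_pmf)
  also have "measure_pmf.prob \<dots> ?E \<le> ?p ^ k"
  proof (rule measure_bind_pmf_le)
    fix g :: "nat \<Rightarrow> nat \<Rightarrow> 'x"
    define Bad where "Bad m = {x :: nat \<Rightarrow> 'x. \<not> near_indep \<epsilon> n x
      (case \<sigma> (inv m) of (m, m', b, b') \<Rightarrow> (\<lambda>i. (y i, g m' i, cB b i, cB b' i)))}" for m
    have "?join g -` ?E \<subseteq> Pi S Bad"
    proof
      fix f assume f: "f \<in> ?join g -` ?E"
      show "f \<in> Pi S Bad"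
      proof
        fix m assume "m \<in> S"
        then obtain j where j: "j < k" "m = ?m j" by (auto simp: S_def)
        obtain m' b b' where sj: "\<sigma> j = (m, m', b, b')" using j(2) by (cases "\<sigma> j") auto
        have "m \<notin> R" "m' \<in> R" using \<open>m \<in> S\<close> disj[OF j(1)] sub[OF j(1)] by (auto simp: R_def sj)
        moreover have "bad_tuple \<epsilon> n (?join g f) cB y (\<sigma> j)" using f j(1) by simp
        ultimately show "f m \<in> Bad m"
          using inv[OF j(1)] by (simp add: Bad_def sj bad_tuple_def)
      qed
    qed
    then have "measure_pmf.prob (map_pmf (?join g) ?PS) ?E \<le> measure_pmf.prob ?PS (Pi S Bad)"
      unfolding measure_map_pmf by (intro measure_pmf.finite_measure_mono) auto
    also have "\<dots> = (\<Prod>m\<in>S. measure_pmf.prob (random_word n) (Bad m))"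
      by (rule measure_Pi_pmf_Pi) (rule fin)
    also have "\<dots> \<le> (\<Prod>m\<in>S. ?p)"
    proof (rule prod_mono, intro conjI)
      fix m
      obtain m' b b' where s: "snd (\<sigma> (inv m)) = (m', b, b')" by (cases "snd (\<sigma> (inv m))") auto
      have "Bad m = {x. \<not> near_indep \<epsilon> n x (\<lambda>i. (y i, g m' i, cB b i, cB b' i))}"
        unfolding Bad_def by (simp add: case_prod_beta s)
      then show "measure_pmf.prob (random_word n) (Bad m) \<le> ?p"
        by (simp only:) (rule prob_not_near_indep_le[OF assms(1)])
    qed simp
    also have "\<dots> = ?p ^ k" by (simp add: cardS)
    finally show "measure_pmf.prob (map_pmf (?join g) ?PS) ?E \<le> ?p ^ k" .
  qed
  finally show ?thesis .
qed

lemma card_words: "card (words n :: (nat \<Rightarrow> 'a::finite) set) = CARD('a) ^ n"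
  by (simp add: words_def card_PiE)

lemma measure_pair_pmf_le:
  assumes "\<And>b. measure_pmf.prob P {a. (a, b) \<in> S} \<le> B"
  shows "measure_pmf.prob (pair_pmf P Q) S \<le> B"
proof -
  have "pair_pmf P Q = bind_pmf Q (\<lambda>b. map_pmf (\<lambda>a. (a, b)) P)"
    unfolding pair_pmf_def map_pmf_def by (rule bind_commute_pmf)
  moreover have "measure_pmf.prob (map_pmf (\<lambda>a. (a, b)) P) S \<le> B" for b
    using assms[of b] by (simp add: vimage_def)
  ultimately show ?thesis by (simp add: measure_bind_pmf_le)
qed

text \<open>A union bound over words and families. The exponent \<open>k\<close> applies to the cost
  and the rarity of a tuple but not to the number of words, which is why a large \<open>k\<close>
  wins.\<close>

lemma prob_many_bad_messages_le:
  fixes n NA NB k :: nat and \<epsilon> :: real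
  assumes "\<epsilon> > 0"
  shows "measure_pmf.prob (pair_pmf (random_book NA n) (random_book NB n))
     {(cA :: nat \<Rightarrow> nat \<Rightarrow> 'x::finite, cB :: nat \<Rightarrow> nat \<Rightarrow> 'y::finite).
        \<exists>y\<in>words n. card (bad_messages \<epsilon> n NA NB cA cB y) \<ge> 3 * k}
     \<le> CARD('y) ^ n * (real (NA * NA * NB * NB) * (real CARD('x \<times> 'y \<times> 'x \<times> 'y \<times> 'y) * (2 * exp (-2 * \<epsilon>\<^sup>2 * n)))) ^ k"
    (is "measure_pmf.prob ?M ?E \<le> _ * (_ * ?p) ^ k")
proof -
  let ?I = "(words n :: (nat \<Rightarrow> 'y) set) \<times> tuple_families k NA NB"
  let ?F = "\<lambda>(y :: nat \<Rightarrow> 'y, \<sigma>). {(cA :: nat \<Rightarrow> nat \<Rightarrow> 'x, cB). \<forall>j<k. bad_tuple \<epsilon> n cA cB y (\<sigma> j)}"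
  have "?E \<subseteq> (\<Union>i\<in>?I. ?F i)"
    using many_bad_messages_imp_bad_family by fastforce
  then have "measure_pmf.prob ?M ?E \<le> measure_pmf.prob ?M (\<Union>i\<in>?I. ?F i)"
    by (intro measure_pmf.finite_measure_mono) auto
  also have "\<dots> \<le> (\<Sum>i\<in>?I. measure_pmf.prob ?M (?F i))"
    by (rule measure_pmf.finite_measure_subadditive_finite) auto
  also have "\<dots> \<le> (\<Sum>i\<in>?I. ?p ^ k)"
  proof (rule sum_mono, clarify, rule measure_pair_pmf_le)
    fix y \<sigma> and b :: "nat \<Rightarrow> nat \<Rightarrow> 'y"
    assume "\<sigma> \<in> tuple_families k NA NB"
    from prob_bad_family_le[OF assms this, of n b y]
    show "measure_pmf.prob (random_book NA n) {a :: nat \<Rightarrow> nat \<Rightarrow> 'x. (a, b) \<in> {(cA, cB). \<forall>j<k. bad_tuple \<epsilon> n cA cB y (\<sigma> j)}} \<le> ?p ^ k"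
      by simp
  qed
  also have "\<dots> = real (CARD('y) ^ n) * real (card (tuple_families k NA NB)) * ?p ^ k"
    by (simp add: card_cartesian_product card_words)
  also have "\<dots> \<le> real (CARD('y) ^ n) * real ((NA * NA * NB * NB) ^ k) * ?p ^ k"
    by (intro mult_right_mono mult_left_mono of_nat_mono card_tuple_families_le) auto
  also have "\<dots> = CARD('y) ^ n * (real (NA * NA * NB * NB) * ?p) ^ k"
    by (subst power_mult_distrib) (simp only: of_nat_power mult.assoc)
  finally show ?thesis .
qed

text \<open>One pair of books must withstand an adversary on either side; with each failure below
  1/2, both are avoided with positive probability.\<close>

lemma ex_good_books:
  fixes n NA NB k :: nat and \<epsilon> :: real
  assumes "\<epsilon> > 0"
    and A: "CARD('y) ^ n * (real (NA * NA * NB * NB) * (real CARD('x \<times> 'y \<times> 'x \<times> 'y \<times> 'y) * (2 * exp (-2 * \<epsilon>\<^sup>2 * n)))) ^ k < 1 / 2"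
    and B: "CARD('x) ^ n * (real (NB * NB * NA * NA) * (real CARD('y \<times> 'x \<times> 'y \<times> 'x \<times> 'x) * (2 * exp (-2 * \<epsilon>\<^sup>2 * n)))) ^ k < 1 / 2"
  shows "\<exists>(cA :: nat \<Rightarrow> nat \<Rightarrow> 'x::finite) (cB :: nat \<Rightarrow> nat \<Rightarrow> 'y::finite).
     (\<forall>m\<in>{1..NA}. cA m \<in> words n) \<and> (\<forall>m\<in>{1..NB}. cB m \<in> words n) \<and>
     (\<forall>y\<in>words n. card (bad_messages \<epsilon> n NA NB cA cB y) < 3 * k) \<and>
     (\<forall>x\<in>words n. card (bad_messages \<epsilon> n NB NA cB cA x) < 3 * k)"
proof -
  let ?M = "pair_pmf (random_book NA n) (random_book NB n) :: ((nat \<Rightarrow> nat \<Rightarrow> 'x) \<times> (nat \<Rightarrow> nat \<Rightarrow> 'y)) pmf"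
  let ?EA = "{(cA :: nat \<Rightarrow> nat \<Rightarrow> 'x, cB :: nat \<Rightarrow> nat \<Rightarrow> 'y). \<exists>y\<in>words n. card (bad_messages \<epsilon> n NA NB cA cB y) \<ge> 3 * k}"
  let ?EB = "{(cA :: nat \<Rightarrow> nat \<Rightarrow> 'x, cB :: nat \<Rightarrow> nat \<Rightarrow> 'y). \<exists>x\<in>words n. card (bad_messages \<epsilon> n NB NA cB cA x) \<ge> 3 * k}"
  have EA: "measure_pmf.prob ?M ?EA < 1 / 2"
    by (rule le_less_trans[OF prob_many_bad_messages_le[OF assms(1)] A])
  have "?M = map_pmf (\<lambda>(b, a). (a, b)) (pair_pmf (random_book NB n) (random_book NA n))"
    by (rule pair_commute_pmf)
  then have "measure_pmf.prob ?M ?EB = measure_pmf.prob (pair_pmf (random_book NB n) (random_book NA n))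
      {(cB :: nat \<Rightarrow> nat \<Rightarrow> 'y, cA :: nat \<Rightarrow> nat \<Rightarrow> 'x). \<exists>x\<in>words n. card (bad_messages \<epsilon> n NB NA cB cA x) \<ge> 3 * k}"
    by (simp add: vimage_def case_prod_unfold)
  also have "\<dots> < 1 / 2"
    by (rule le_less_trans[OF prob_many_bad_messages_le[OF assms(1)] B])
  finally have EB: "measure_pmf.prob ?M ?EB < 1 / 2" .
  have "measure_pmf.prob ?M (?EA \<union> ?EB) < 1"
    using EA EB measure_Un_le[of ?EA ?M ?EB] by simp
  \<comment> \<open>The pair is taken from the support, so that its codewords are words of length
    \<open>n\<close>.\<close>
  then have "\<not> set_pmf ?M \<subseteq> ?EA \<union> ?EB"
    using measure_pmf.prob_eq_1[of "?EA \<union> ?EB" ?M] by (auto simp: AE_measure_pmf_iff)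
  then obtain p where p: "p \<in> set_pmf ?M" "p \<notin> ?EA" "p \<notin> ?EB" by blast
  obtain cA cB where "p = (cA, cB)" by (cases p)
  with p have "cA \<in> set_pmf (random_book NA n)" "cB \<in> set_pmf (random_book NB n)"
    "(cA, cB) \<notin> ?EA" "(cA, cB) \<notin> ?EB"
    by simp_all
  then show ?thesis
    by (intro exI[of _ cA] exI[of _ cB]) (auto simp: not_le random_book_words)
qed

section \<open>Achievability\<close>

text \<open>Both lists empty gives \<open>Adversary_A\<close>; such an output misses the message of
  every honest user and is already charged as an error. \<open>SOME\<close> is reached only when
  both lists are nonempty, where separation leaves one choice.\<close>

definition cand_code :: "('x::finite, 'y::finite, 'z::finite) mac \<Rightarrow> real \<Rightarrow> nat \<Rightarrow> nat \<Rightarrow> nat \<Rightarrow>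
    (nat \<Rightarrow> nat \<Rightarrow> 'x) \<Rightarrow> (nat \<Rightarrow> nat \<Rightarrow> 'y) \<Rightarrow> ('x, 'y, 'z) code" where
  "cand_code W \<epsilon> n NA NB cA cB = \<lparr>enc_A = cA, enc_B = cB, dec = (\<lambda>z.
     if cand W \<epsilon> n NA NB cA cB z = {} then Adversary_A
     else if cand (swap_mac W) \<epsilon> n NB NA cB cA z = {} then Adversary_B
     else Messages (SOME m. m \<in> cand W \<epsilon> n NA NB cA cB z)
       (SOME m. m \<in> cand (swap_mac W) \<epsilon> n NB NA cB cA z))\<rparr>"

lemma cand_subset: "cand W \<epsilon> n NA NB cA cB z \<subseteq> {1..NA}"
  by (auto simp: cand_def)

lemma some_in_cand: "cand W \<epsilon> n NA NB cA cB z \<noteq> {} \<Longrightarrow> (SOME m. m \<in> cand W \<epsilon> n NA NB cA cB z) \<in> {1..NA}"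
  using cand_subset some_in_eq by blast

lemma adversary_identifying_cand_code:
  assumes "n \<ge> 1" "NA \<ge> 1" "NB \<ge> 1" "\<forall>m\<in>{1..NA}. cA m \<in> words n" "\<forall>m\<in>{1..NB}. cB m \<in> words n"
  shows "adversary_identifying_code NA NB n (cand_code W \<epsilon> n NA NB cA cB)"
  unfolding adversary_identifying_code_def
proof (intro conjI)
  let ?c = "cand_code W \<epsilon> n NA NB cA cB"
  show "dec ?c \<in> words n \<rightarrow>
      {Messages mA mB | mA mB. mA \<in> {1..NA} \<and> mB \<in> {1..NB}} \<union> {Adversary_A, Adversary_B}"
  proof
    fix z
    show "dec ?c z \<in> {Messages mA mB | mA mB. mA \<in> {1..NA} \<and> mB \<in> {1..NB}} \<union> {Adversary_A, Adversary_B}"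
      unfolding cand_code_def using some_in_cand[of W] some_in_cand[of "swap_mac W"] by simp
  qed
qed (use assms in \<open>auto simp: cand_code_def\<close>)

text \<open>Bad messages are charged with probability 1 and contribute the first term; for the
  others a union bound over the side information gives the second.\<close>

lemma avg_prob_not_cand_le:
  fixes W :: "('x::finite, 'y::finite, 'z::finite) mac" and n NA NB k :: nat and \<epsilon> :: real
  assumes \<epsilon>: "\<epsilon> > 0" and y: "y \<in> words n" and NA: "NA \<ge> 1"
    and bad: "card (bad_messages (\<epsilon> / 2) n NA NB cA cB y) < 3 * k"
  shows "1 / real NA * (\<Sum>m\<in>{1..NA}. measure_pmf.prob (product_channel W n (cA m) y)
            {z. m \<notin> cand W \<epsilon> n NA NB cA cB z})
     \<le> 3 * k / NA + real (NA * NB * NB) * (real CARD('x \<times> 'y \<times> ('x \<times> 'y \<times> 'y) \<times> 'z) * (2 * exp (- (\<epsilon>\<^sup>2 / 2 * n))))"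
    (is "_ * (\<Sum>m\<in>_. ?P m) \<le> _ + _ * ?p")
proof -
  let ?B = "bad_messages (\<epsilon> / 2) n NA NB cA cB y"
  let ?T = "real (NA * NB * NB) * ?p"
  have T: "0 \<le> ?T" by simp
  have each: "?P m \<le> (if m \<in> ?B then 1 else 0) + ?T" if m: "m \<in> {1..NA}" for m
  proof (cases "m \<in> ?B")
    case True
    then show ?thesis using T measure_pmf.prob_le_1 by (simp add: add_increasing2)
  next
    case False
    let ?I = "({1..NA} - {m}) \<times> {1..NB} \<times> {1..NB}"
    let ?s = "\<lambda>(m', b, b') i. (cA m' i, cB b i, cB b' i)"
    \<comment> \<open>The word \<open>y\<close> actually sent is the witness for the explaining word
      in \<open>cand\<close>.\<close>
    have "{z. m \<notin> cand W \<epsilon> n NA NB cA cB z} \<subseteq> (\<Union>j\<in>?I. {z. \<not> typical W \<epsilon> n (cA m) y (?s j) z})"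
      using m y unfolding cand_def by fastforce
    then have "?P m \<le> measure_pmf.prob (product_channel W n (cA m) y) (\<Union>j\<in>?I. {z. \<not> typical W \<epsilon> n (cA m) y (?s j) z})"
      by (intro measure_pmf.finite_measure_mono) auto
    also have "\<dots> \<le> (\<Sum>j\<in>?I. measure_pmf.prob (product_channel W n (cA m) y) {z. \<not> typical W \<epsilon> n (cA m) y (?s j) z})"
      by (rule measure_pmf.finite_measure_subadditive_finite) auto
    also have "\<dots> \<le> (\<Sum>j\<in>?I. ?p)"
    proof (rule sum_mono)
      fix j assume j: "j \<in> ?I"
      obtain m' b b' where jj: "j = (m', b, b')" by (cases j)
      have "near_indep (\<epsilon> / 2) n (cA m) (\<lambda>i. (y i, ?s j i))"
        using False m j unfolding bad_messages_def jj by auto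
      then show "measure_pmf.prob (product_channel W n (cA m) y) {z. \<not> typical W \<epsilon> n (cA m) y (?s j) z} \<le> ?p"
        by (rule prob_not_typical_le[OF \<epsilon>])
    qed
    also have "\<dots> = real (card ?I) * ?p" by simp
    also have "\<dots> \<le> ?T"
    proof (rule mult_right_mono)
      have "card ?I \<le> card ({1..NA} \<times> {1..NB} \<times> {1..NB})" by (rule card_mono) auto
      then show "real (card ?I) \<le> real (NA * NB * NB)"
        unfolding of_nat_le_iff by (simp add: card_cartesian_product mult.assoc)
    qed simp
    finally show ?thesis using False by simp
  qed
  have "(\<Sum>m\<in>{1..NA}. ?P m) \<le> (\<Sum>m\<in>{1..NA}. (if m \<in> ?B then 1 else 0) + ?T)"
    by (rule sum_mono) (rule each)
  also have "\<dots> = real (card ?B) + NA * ?T"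
  proof -
    have "{1..NA} \<inter> ?B = ?B" by (auto simp: bad_messages_def)
    then have "(\<Sum>m\<in>{1..NA}. if m \<in> ?B then 1 else (0::real)) = card ?B"
      by (subst sum.If_cases) (auto simp: Collect_mem_eq)
    then show ?thesis by (simp only: sum.distrib) simp
  qed
  also have "\<dots> \<le> 3 * k + NA * ?T" using bad by simp
  finally show ?thesis using NA by (simp add: field_simps)
qed

text \<open>By separation, an honest user is treated correctly as soon as its message is a
  candidate. A malicious B thus costs \<open>dA\<close>, a malicious A costs \<open>dB\<close>, and
  the honest case needs both messages.\<close>

lemma Pe_cand_code_le:
  fixes W :: "('x::finite, 'y::finite, 'z::finite) mac" and n NA NB :: nat and \<epsilon> :: real
  defines "c cA cB \<equiv> cand_code W \<epsilon> n NA NB cA cB"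
  assumes NA: "NA \<ge> 1" and NB: "NB \<ge> 1"
    and wA: "\<forall>m\<in>{1..NA}. cA m \<in> words n" and wB: "\<forall>m\<in>{1..NB}. cB m \<in> words n"
    and sepA: "\<And>z m1 m2 b. \<lbrakk>m1 \<in> cand W \<epsilon> n NA NB cA cB z; m2 \<in> cand W \<epsilon> n NA NB cA cB z;
       b \<in> cand (swap_mac W) \<epsilon> n NB NA cB cA z\<rbrakk> \<Longrightarrow> m1 = m2"
    and sepB: "\<And>z m1 m2 b. \<lbrakk>m1 \<in> cand (swap_mac W) \<epsilon> n NB NA cB cA z; m2 \<in> cand (swap_mac W) \<epsilon> n NB NA cB cA z;
       b \<in> cand W \<epsilon> n NA NB cA cB z\<rbrakk> \<Longrightarrow> m1 = m2"
    and dA: "\<And>y. y \<in> words n \<Longrightarrow> 1 / real NA * (\<Sum>m\<in>{1..NA}. measure_pmf.prob (product_channel W n (cA m) y)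
            {z. m \<notin> cand W \<epsilon> n NA NB cA cB z}) \<le> dA"
    and dB: "\<And>x. x \<in> words n \<Longrightarrow> 1 / real NB * (\<Sum>m\<in>{1..NB}. measure_pmf.prob (product_channel W n x (cB m))
            {z. m \<notin> cand (swap_mac W) \<epsilon> n NB NA cB cA z}) \<le> dB"
  shows "Pe W NA NB n (c cA cB) \<le> dA + dB"
proof -
  let ?c = "c cA cB"
  let ?A = "cand W \<epsilon> n NA NB cA cB" and ?B = "cand (swap_mac W) \<epsilon> n NB NA cB cA"
  have enc: "enc_A ?c = cA" "enc_B ?c = cB" by (simp_all add: c_def cand_code_def)
  have someA: "(SOME m. m \<in> ?A z) = m" if "m \<in> ?A z" "b \<in> ?B z" for m b z
    using sepA[OF _ that] someI[of "\<lambda>m. m \<in> ?A z", OF that(1)] by blast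
  have someB: "(SOME m. m \<in> ?B z) = m" if "m \<in> ?B z" "b \<in> ?A z" for m b z
    using sepB[OF _ that] someI[of "\<lambda>m. m \<in> ?B z", OF that(1)] by blast
  have dec: "dec ?c z = (if ?A z = {} then Adversary_A else if ?B z = {} then Adversary_B
     else Messages (SOME m. m \<in> ?A z) (SOME m. m \<in> ?B z))" for z
    by (simp add: c_def cand_code_def)
  have decA: "dec ?c z \<in> {Messages m mB | mB. mB \<in> {1..NB}} \<union> {Adversary_B}" if "m \<in> ?A z" for m z
  proof (cases "?B z = {}")
    case False
    then obtain b where "b \<in> ?B z" by blast
    moreover have "b \<in> {1..NB}" using \<open>b \<in> ?B z\<close> cand_subset[of "swap_mac W"] by blast
    ultimately show ?thesis using that by (auto simp: dec someA someB)
  qed (use that in \<open>auto simp: dec\<close>)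
  have decB: "dec ?c z \<in> {Messages mA m | mA. mA \<in> {1..NA}} \<union> {Adversary_A}" if "m \<in> ?B z" for m z
  proof (cases "?A z = {}")
    case False
    then obtain b where "b \<in> ?A z" by blast
    moreover have "b \<in> {1..NA}" using \<open>b \<in> ?A z\<close> cand_subset[of W] by blast
    ultimately show ?thesis using that by (auto simp: dec someA someB)
  qed (auto simp: dec)
  have decAB: "dec ?c z = Messages mA mB" if "mA \<in> ?A z" "mB \<in> ?B z" for mA mB z
    using that by (auto simp: dec someA someB)
  let ?PA = "\<lambda>mA y. measure_pmf.prob (product_channel W n (cA mA) y) {z. mA \<notin> ?A z}"
  let ?PB = "\<lambda>mB x. measure_pmf.prob (product_channel W n x (cB mB)) {z. mB \<notin> ?B z}"
  obtain w :: "nat \<Rightarrow> 'x" where w: "w \<in> words n" using words_nonempty by blast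
  obtain w' :: "nat \<Rightarrow> 'y" where w': "w' \<in> words n" using words_nonempty by blast
  \<comment> \<open>Nonnegativity lets \<open>dA + dB\<close> dominate each malicious error; it is
    read off from the hypothesis at some word.\<close>
  have dA0: "0 \<le> dA"
    by (rule order.trans[OF _ dA[OF w']]) (auto intro!: sum_nonneg divide_nonneg_nonneg)
  have dB0: "0 \<le> dB"
    by (rule order.trans[OF _ dB[OF w]]) (auto intro!: sum_nonneg divide_nonneg_nonneg)
  have malB: "Pe_mal_B W NA NB n ?c \<le> dA"
    unfolding Pe_mal_B_def
  proof (rule Max.boundedI; (elim imageE)?)
    fix r and y :: "nat \<Rightarrow> 'y" assume y: "y \<in> words n"
      and r: "r = 1 / real NA * (\<Sum>mA\<in>{1..NA}. measure_pmf.prob (product_channel W n (enc_A ?c mA) y)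
            {z. dec ?c z \<notin> {Messages mA mB | mB. mB \<in> {1..NB}} \<union> {Adversary_B}})"
    have "r \<le> 1 / real NA * (\<Sum>m\<in>{1..NA}. ?PA m y)"
      unfolding r enc
      by (intro mult_left_mono sum_mono measure_pmf.finite_measure_mono) (use decA in auto)
    also have "\<dots> \<le> dA" by (rule dA[OF y])
    finally show "r \<le> dA" .
  qed auto
  have malA: "Pe_mal_A W NA NB n ?c \<le> dB"
    unfolding Pe_mal_A_def
  proof (rule Max.boundedI; (elim imageE)?)
    fix r and x :: "nat \<Rightarrow> 'x" assume x: "x \<in> words n"
      and r: "r = 1 / real NB * (\<Sum>mB\<in>{1..NB}. measure_pmf.prob (product_channel W n x (enc_B ?c mB))
            {z. dec ?c z \<notin> {Messages mA mB | mA. mA \<in> {1..NA}} \<union> {Adversary_A}})"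
    have "r \<le> 1 / real NB * (\<Sum>m\<in>{1..NB}. ?PB m x)"
      unfolding r enc
      by (intro mult_left_mono sum_mono measure_pmf.finite_measure_mono) (use decB in auto)
    also have "\<dots> \<le> dB" by (rule dB[OF x])
    finally show "r \<le> dB" .
  qed auto
  have hon: "Pe_hon W NA NB n ?c \<le> dA + dB"
  proof -
    have "measure_pmf.prob (product_channel W n (cA mA) (cB mB)) {z. dec ?c z \<noteq> Messages mA mB} \<le>
       ?PA mA (cB mB) + ?PB mB (cA mA)" for mA mB
      by (rule order.trans[OF _ measure_Un_le], rule measure_pmf.finite_measure_mono)
         (use decAB in auto)
    then have "(\<Sum>mA\<in>{1..NA}. \<Sum>mB\<in>{1..NB}. measure_pmf.prob (product_channel W n (cA mA) (cB mB)) {z. dec ?c z \<noteq> Messages mA mB})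
      \<le> (\<Sum>mA\<in>{1..NA}. \<Sum>mB\<in>{1..NB}. ?PA mA (cB mB) + ?PB mB (cA mA))"
      by (intro sum_mono)
    also have "\<dots> = (\<Sum>mB\<in>{1..NB}. \<Sum>mA\<in>{1..NA}. ?PA mA (cB mB)) + (\<Sum>mA\<in>{1..NA}. \<Sum>mB\<in>{1..NB}. ?PB mB (cA mA))"
      unfolding sum.distrib by (subst sum.swap) (rule refl)
    \<comment> \<open>An honest partner is a special attack: \<open>dA\<close> is applied at the
      codeword \<open>cB mB\<close>, and \<open>dB\<close> at \<open>cA mA\<close>.\<close>
    also have "\<dots> \<le> (\<Sum>mB\<in>{1..NB}. NA * dA) + (\<Sum>mA\<in>{1..NA}. NB * dB)"
    proof (intro add_mono sum_mono)
      show "(\<Sum>mA\<in>{1..NA}. ?PA mA (cB mB)) \<le> NA * dA" if "mB \<in> {1..NB}" for mB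
        using dA[of "cB mB"] wB that NA by (simp add: field_simps)
      show "(\<Sum>mB\<in>{1..NB}. ?PB mB (cA mA)) \<le> NB * dB" if "mA \<in> {1..NA}" for mA
        using dB[of "cA mA"] wA that NB by (simp add: field_simps)
    qed
    also have "\<dots> = (real NA * real NB) * (dA + dB)" by (simp add: algebra_simps)
    finally show ?thesis unfolding Pe_hon_def enc using NA NB by (simp add: field_simps)
  qed
  show ?thesis unfolding Pe_def using malA malB hon dA0 dB0 by simp
qed

section \<open>Growth of the message sets and decay of the error bounds\<close>

lemma num_messages_bounds:
  assumes "R \<ge> 0"
  shows "real (num_messages R n) \<le> 2 powr (real n * R)"
    and "2 powr (real n * R) - 1 \<le> real (num_messages R n)"
    and "num_messages R n \<ge> 1"
proof -
  have "1 \<le> (2::real) powr (real n * R)"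
    using assms by (intro ge_one_powr_ge_zero) auto
  then show "real (num_messages R n) \<le> 2 powr (real n * R)"
    "2 powr (real n * R) - 1 \<le> real (num_messages R n)" "num_messages R n \<ge> 1"
    unfolding num_messages_def by linarith+
qed

lemma num_messages_at_top:
  assumes "R > 0"
  shows "filterlim (\<lambda>n. real (num_messages R n)) at_top sequentially"
proof (rule filterlim_at_top_mono)
  show "filterlim (\<lambda>n. R * ln 2 * real n) at_top sequentially"
    using assms by (intro filterlim_tendsto_pos_mult_at_top[OF tendsto_const _ filterlim_real_sequentially]) auto
  have "R * ln 2 * real n \<le> real (num_messages R n)" for n
  proof -
    have "R * ln 2 * real n \<le> 2 powr (real n * R) - 1"
    proof -
      have "2 powr (real n * R) = exp (R * ln 2 * real n)"
        by (simp add: powr_def mult_ac)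
      then show ?thesis
        using exp_ge_add_one_self[of "R * ln 2 * real n"] by linarith
    qed
    also have "\<dots> \<le> real (num_messages R n)"
      using assms by (intro num_messages_bounds) auto
    finally show ?thesis .
  qed
  then show "eventually (\<lambda>n. R * ln 2 * real n \<le> real (num_messages R n)) sequentially"
    by simp
qed

text \<open>A rate below \<open>\<gamma> / (8 * ln 2)\<close> gives at most exp(\<gamma> n / 8)
  messages. A bad tuple involves four of them, which uses half of the exponent \<gamma>.\<close>

lemma powr_rate_le:
  fixes \<gamma> :: real
  assumes \<gamma>: "\<gamma> > 0" and "0 < RA" "RA < \<gamma> / (8 * ln 2)" "0 < RB" "RB < \<gamma> / (8 * ln 2)"
  shows "real (num_messages RA n) ^ 2 * real (num_messages RB n) ^ 2 \<le> exp (\<gamma> / 2 * n)"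
proof -
  have *: "real (num_messages R n) \<le> exp (\<gamma> / 8 * n)" if "0 < R" "R < \<gamma> / (8 * ln 2)" for R
  proof -
    have "real (num_messages R n) \<le> 2 powr (real n * R)" using that by (intro num_messages_bounds) auto
    also have "\<dots> = exp (real n * (R * ln 2))" by (simp add: powr_def)
    also have "\<dots> \<le> exp (real n * (\<gamma> / 8))"
    proof -
      have "R * ln 2 \<le> \<gamma> / 8" using that(2) by (simp add: field_simps)
      then show ?thesis by (intro iffD2[OF exp_le_cancel_iff] mult_left_mono) auto
    qed
    finally show ?thesis by (simp add: mult.commute)
  qed
  have "real (num_messages RA n) ^ 2 * real (num_messages RB n) ^ 2 \<le> exp (\<gamma> / 8 * n) ^ 2 * exp (\<gamma> / 8 * n) ^ 2"
    using assms by (intro mult_mono power_mono *) auto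
  also have "\<dots> = exp (\<gamma> / 2 * n)" by (simp flip: exp_of_nat_mult exp_add)
  finally show ?thesis .
qed

lemma tendsto_exp_neg_mult:
  assumes "(c::real) > 0"
  shows "(\<lambda>n. exp (- (c * real n))) \<longlonglongrightarrow> 0"
proof -
  have "exp (- (c * real n)) = exp (- c) ^ n" for n
    by (simp add: mult.commute flip: exp_of_nat_mult)
  moreover have "(\<lambda>n. exp (- c) ^ n) \<longlonglongrightarrow> 0"
    using assms by (intro LIMSEQ_realpow_zero) auto
  ultimately show ?thesis by simp
qed

text \<open>After paying for the tuples, each of the \<open>k\<close> factors still decays like
  exp(-\<gamma> n / 2). The lower bound on \<open>k\<close> makes their product cancel
  \<open>q ^ n\<close> and leaves exp(-n).\<close>

lemma eventually_union_bound_small: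
  fixes D \<gamma> :: real and q :: nat
  assumes \<gamma>: "\<gamma> > 0" and D: "D \<ge> 0" and q: "q \<ge> 1" and k: "real k \<ge> 2 * (ln q + 1) / \<gamma>"
    and N: "\<And>n. 0 \<le> N n" "\<And>n. N n \<le> exp (\<gamma> / 2 * real n)"
  shows "eventually (\<lambda>n. real q ^ n * (N n * (D * (2 * exp (- (\<gamma> * n))))) ^ k < 1 / 2) sequentially"
proof -
  have "(\<lambda>n. (2 * D) ^ k * exp (- (1 * real n))) \<longlonglongrightarrow> (2 * D) ^ k * 0"
    by (intro tendsto_intros tendsto_exp_neg_mult) auto
  then have "eventually (\<lambda>n. (2 * D) ^ k * exp (- (1 * real n)) < 1 / 2) sequentially"
    by (rule order_tendstoD) auto
  then show ?thesis
  proof (rule eventually_mono)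
    fix n
    assume *: "(2 * D) ^ k * exp (- (1 * real n)) < 1 / 2"
    have kg: "ln q + 1 \<le> k * \<gamma> / 2" using k \<gamma> by (simp add: field_simps)
    have "N n * (D * (2 * exp (- (\<gamma> * n)))) \<le> exp (\<gamma> / 2 * real n) * (D * (2 * exp (- (\<gamma> * n))))"
      using D by (intro mult_right_mono N) auto
    also have "\<dots> = (2 * D) * (exp (\<gamma> / 2 * real n) * exp (- (\<gamma> * n)))" by simp
    also have "exp (\<gamma> / 2 * real n) * exp (- (\<gamma> * n)) = exp (- (\<gamma> / 2 * n))"
      by (simp flip: exp_add)
    finally have 1: "N n * (D * (2 * exp (- (\<gamma> * n)))) \<le> 2 * D * exp (- (\<gamma> / 2 * n))" .
    have "real q ^ n * (N n * (D * (2 * exp (- (\<gamma> * n))))) ^ k \<le> real q ^ n * (2 * D * exp (- (\<gamma> / 2 * n))) ^ k"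
      using D N by (intro mult_left_mono power_mono 1) auto
    also have "\<dots> = exp (real n * ln q) * ((2 * D) ^ k * exp (- (real k * (\<gamma> / 2 * n))))"
    proof -
      have "real q ^ n = exp (real n * ln q)"
        using q by (simp add: exp_of_nat_mult)
      moreover have "(2 * D * exp (- (\<gamma> / 2 * n))) ^ k = (2 * D) ^ k * exp (- (real k * (\<gamma> / 2 * n)))"
        by (simp add: power_mult_distrib flip: exp_of_nat_mult)
      ultimately show ?thesis by simp
    qed
    also have "exp (real n * ln q) * ((2 * D) ^ k * exp (- (real k * (\<gamma> / 2 * n)))) =
       (2 * D) ^ k * exp (real n * (ln q - k * \<gamma> / 2))"
      by (simp add: algebra_simps flip: exp_add)
    also have "\<dots> \<le> (2 * D) ^ k * exp (real n * (- 1))"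
      using D kg by (intro mult_left_mono iffD2[OF exp_le_cancel_iff]) auto
    also have "\<dots> < 1 / 2" using * by simp
    finally show "real q ^ n * (N n * (D * (2 * exp (- (\<gamma> * n))))) ^ k < 1 / 2" .
  qed
qed

text \<open>The share of bad messages vanishes because a positive rate makes the message set grow;
  the noise term keeps the decay exp(-\<gamma> n / 2).\<close>

lemma error_bound_tendsto_0:
  fixes D \<gamma> :: real
  assumes "\<gamma> > 0" "D \<ge> 0" "R > 0" and N: "\<And>n. 0 \<le> N n" "\<And>n. N n \<le> exp (\<gamma> / 2 * real n)"
  shows "(\<lambda>n. 3 * real k / real (num_messages R n) + N n * (D * (2 * exp (- (\<gamma> * n))))) \<longlonglongrightarrow> 0"
proof -
  have "(\<lambda>n. 3 * real k / real (num_messages R n)) \<longlonglongrightarrow> 0"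
    by (intro tendsto_divide_0[OF tendsto_const] filterlim_at_top_imp_at_infinity num_messages_at_top assms)
  moreover have "(\<lambda>n. N n * (D * (2 * exp (- (\<gamma> * n))))) \<longlonglongrightarrow> 0"
  proof (rule tendsto_sandwich[of "\<lambda>_. 0"])
    show "(\<lambda>n. 2 * D * exp (- (\<gamma> / 2 * real n))) \<longlonglongrightarrow> 0"
      using tendsto_mult_right_zero[OF tendsto_exp_neg_mult[of "\<gamma> / 2"]] assms by simp
    show "eventually (\<lambda>n. N n * (D * (2 * exp (- (\<gamma> * n)))) \<le> 2 * D * exp (- (\<gamma> / 2 * real n))) sequentially"
    proof (rule always_eventually, rule allI)
      fix n
      have "N n * (D * (2 * exp (- (\<gamma> * n)))) \<le> exp (\<gamma> / 2 * real n) * (D * (2 * exp (- (\<gamma> * n))))"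
        using assms by (intro mult_right_mono N) auto
      also have "\<dots> = (2 * D) * (exp (\<gamma> / 2 * real n) * exp (- (\<gamma> * n)))" by simp
      also have "exp (\<gamma> / 2 * real n) * exp (- (\<gamma> * n)) = exp (- (\<gamma> / 2 * n))"
        by (simp flip: exp_add)
      finally show "N n * (D * (2 * exp (- (\<gamma> * n)))) \<le> 2 * D * exp (- (\<gamma> / 2 * n))" .
    qed
  qed (use assms in \<open>auto intro!: always_eventually mult_nonneg_nonneg\<close>)
  ultimately show ?thesis
    using tendsto_add[of _ 0 _ _ 0] by fastforce
qed

text \<open>A filler: \<open>achievable\<close> asks for a code at every \<open>n >= 1\<close>, also
  where the random construction does not yet succeed.\<close>

lemma ex_adversary_identifying_code:
  assumes "n \<ge> 1" "NA \<ge> 1" "NB \<ge> 1"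
  shows "\<exists>c :: ('x, 'y, 'z) code. adversary_identifying_code NA NB n c"
  by (rule exI[of _ "\<lparr>enc_A = \<lambda>_ _. undefined, enc_B = \<lambda>_ _. undefined, dec = \<lambda>_. Adversary_A\<rparr>"])
     (use assms in \<open>auto simp: adversary_identifying_code_def words_def\<close>)

lemma Pe_nonneg: "0 \<le> Pe W NA NB n c"
  by (rule order.trans[OF _ Pe_bounds(1)]) (auto simp: Pe_hon_def intro!: sum_nonneg divide_nonneg_nonneg)

lemma achievable_small_rates:
  fixes W :: "('x::finite, 'y::finite, 'z::finite) mac"
  assumes "\<not> A_spoofable W" "\<not> B_spoofable W"
  obtains \<delta> where "\<delta> > 0" "\<And>RA RB. \<lbrakk>0 < RA; RA < \<delta>; 0 < RB; RB < \<delta>\<rbrakk> \<Longrightarrow> achievable W (RA, RB)"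
proof -
  obtain \<epsilon>A where \<epsilon>A: "\<epsilon>A > 0" and sepA: "\<And>\<epsilon> n NA NB cA cB z m1 m2 b. \<lbrakk>0 \<le> \<epsilon>; \<epsilon> \<le> \<epsilon>A; n \<ge> 1; NB \<ge> 2;
       m1 \<in> cand W \<epsilon> n NA NB cA cB z; m2 \<in> cand W \<epsilon> n NA NB cA cB z;
       b \<in> cand (swap_mac W) \<epsilon> n NB NA cB cA z\<rbrakk> \<Longrightarrow> m1 = m2"
    using cand_separation[OF assms(1)] by metis
  have "\<not> A_spoofable (swap_mac W)" using assms(2) by (simp add: A_spoofable_swap)
  from cand_separation[OF this]
  obtain \<epsilon>B where \<epsilon>B: "\<epsilon>B > 0" and sepB: "\<And>\<epsilon> n NA NB cA cB z m1 m2 b. \<lbrakk>0 \<le> \<epsilon>; \<epsilon> \<le> \<epsilon>B; n \<ge> 1; NB \<ge> 2;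
       m1 \<in> cand (swap_mac W) \<epsilon> n NA NB cA cB z; m2 \<in> cand (swap_mac W) \<epsilon> n NA NB cA cB z;
       b \<in> cand (swap_mac (swap_mac W)) \<epsilon> n NB NA cB cA z\<rbrakk> \<Longrightarrow> m1 = m2"
    by metis
  define \<epsilon> where "\<epsilon> = min \<epsilon>A \<epsilon>B"
  have \<epsilon>: "\<epsilon> > 0" "\<epsilon> \<le> \<epsilon>A" "\<epsilon> \<le> \<epsilon>B" using \<epsilon>A \<epsilon>B by (auto simp: \<epsilon>_def)
  \<comment> \<open>Both exponents agree: near independence at half the tolerance gives
    \<open>2 * (\<epsilon> / 2)^2\<close>, and typicality gives the same value.\<close>
  define \<gamma> where "\<gamma> = \<epsilon>\<^sup>2 / 2"
  have \<gamma>: "\<gamma> > 0" using \<epsilon> by (simp add: \<gamma>_def)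
  have \<gamma>': "-2 * (\<epsilon> / 2)\<^sup>2 * real n = - (\<gamma> * n)" for n
    by (simp add: \<gamma>_def power_divide)
  \<comment> \<open>Large enough for the words of both alphabets, since either user may be the
    adversary.\<close>
  define k where "k = nat \<lceil>max (2 * (ln CARD('x) + 1) / \<gamma>) (2 * (ln CARD('y) + 1) / \<gamma>)\<rceil>"
  have k: "real k \<ge> 2 * (ln CARD('x) + 1) / \<gamma>" "real k \<ge> 2 * (ln CARD('y) + 1) / \<gamma>"
    unfolding k_def by linarith+
  show thesis
  proof (rule that[of "\<gamma> / (8 * ln 2)"])
    show "\<gamma> / (8 * ln 2) > 0" using \<gamma> by simp
  next
    fix RA RB
    assume R: "0 < RA" "RA < \<gamma> / (8 * ln 2)" "0 < RB" "RB < \<gamma> / (8 * ln 2)"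
    define NA where "NA = num_messages RA"
    define NB where "NB = num_messages RB"
    have N1: "NA n \<ge> 1" "NB n \<ge> 1" for n
      unfolding NA_def NB_def
      using R num_messages_bounds(3)[of RA n] num_messages_bounds(3)[of RB n] by simp_all
    have N4: "real (NA n) ^ 2 * real (NB n) ^ 2 \<le> exp (\<gamma> / 2 * real n)" for n
      unfolding NA_def NB_def by (rule powr_rate_le[OF \<gamma> R])
    have N4': "real (NA n * NA n * NB n * NB n) \<le> exp (\<gamma> / 2 * real n)"
      "real (NB n * NB n * NA n * NA n) \<le> exp (\<gamma> / 2 * real n)" for n
      using N4[of n] by (simp_all add: power2_eq_square mult_ac)
    have N3: "real (NA n * NB n * NB n) \<le> exp (\<gamma> / 2 * real n)" "real (NB n * NA n * NA n) \<le> exp (\<gamma> / 2 * real n)" for n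
    proof -
      have "NA n * NB n * NB n \<le> NA n * (NA n * NB n * NB n)" "NB n * NA n * NA n \<le> NB n * (NB n * NA n * NA n)"
        using N1[of n] by simp_all
      then have "real (NA n * NB n * NB n) \<le> real (NA n * (NA n * NB n * NB n))"
        "real (NB n * NA n * NA n) \<le> real (NB n * (NB n * NA n * NA n))"
        by (simp_all only: of_nat_le_iff)
      then show "real (NA n * NB n * NB n) \<le> exp (\<gamma> / 2 * real n)" "real (NB n * NA n * NA n) \<le> exp (\<gamma> / 2 * real n)"
        using N4'[of n] by (simp_all add: mult_ac)
    qed
    let ?DA = "real CARD('x \<times> 'y \<times> ('x \<times> 'y \<times> 'y) \<times> 'z)" and ?DB = "real CARD('y \<times> 'x \<times> ('y \<times> 'x \<times> 'x) \<times> 'z)"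
    define dA where "dA n = 3 * real k / NA n + real (NA n * NB n * NB n) * (?DA * (2 * exp (- (\<gamma> * n))))" for n
    define dB where "dB n = 3 * real k / NB n + real (NB n * NA n * NA n) * (?DB * (2 * exp (- (\<gamma> * n))))" for n
    have dA: "dA \<longlonglongrightarrow> 0"
      unfolding dA_def using N3(1) unfolding NA_def
      by (intro error_bound_tendsto_0 \<gamma> R) auto
    have dB: "dB \<longlonglongrightarrow> 0"
      unfolding dB_def using N3(2) unfolding NB_def
      by (intro error_bound_tendsto_0 \<gamma> R) auto
    let ?DA' = "real CARD('x \<times> 'y \<times> 'x \<times> 'y \<times> 'y)" and ?DB' = "real CARD('y \<times> 'x \<times> 'y \<times> 'x \<times> 'x)"
    \<comment> \<open>Two messages per user are demanded by separation, the two inequalities by the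
      existence of good books.\<close>
    define good where "good n \<longleftrightarrow> n \<ge> 1 \<and> NA n \<ge> 2 \<and> NB n \<ge> 2 \<and>
      CARD('y) ^ n * (real (NA n * NA n * NB n * NB n) * (?DA' * (2 * exp (- (\<gamma> * n))))) ^ k < 1 / 2 \<and>
      CARD('x) ^ n * (real (NB n * NB n * NA n * NA n) * (?DB' * (2 * exp (- (\<gamma> * n))))) ^ k < 1 / 2" for n
    have ev_N: "eventually (\<lambda>n. num_messages R n \<ge> 2) sequentially" if "R > 0" for R
    proof -
      have "eventually (\<lambda>n. real (num_messages R n) \<ge> 2) sequentially"
        using num_messages_at_top[OF that] unfolding filterlim_at_top by blast
      then show ?thesis by (rule eventually_mono) simp
    qed
    have "eventually good sequentially"
      unfolding good_def of_nat_power
      using R \<gamma> k N4' unfolding NA_def NB_def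
      by (intro eventually_conj eventually_ge_at_top ev_N eventually_union_bound_small) auto
    have "\<exists>c :: ('x, 'y, 'z) code. n \<ge> 1 \<longrightarrow> adversary_identifying_code (NA n) (NB n) n c \<and>
       (good n \<longrightarrow> Pe W (NA n) (NB n) n c \<le> dA n + dB n)" for n
    proof (cases "good n")
      case False
      then show ?thesis using ex_adversary_identifying_code[of n "NA n" "NB n"] N1 by blast
    next
      case True
      then have g: "n \<ge> 1" "NA n \<ge> 2" "NB n \<ge> 2" by (auto simp: good_def)
      obtain cA :: "nat \<Rightarrow> nat \<Rightarrow> 'x" and cB :: "nat \<Rightarrow> nat \<Rightarrow> 'y" where
        w: "\<forall>m\<in>{1..NA n}. cA m \<in> words n" "\<forall>m\<in>{1..NB n}. cB m \<in> words n" and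
        bad: "\<forall>y\<in>words n. card (bad_messages (\<epsilon> / 2) n (NA n) (NB n) cA cB y) < 3 * k"
         "\<forall>x\<in>words n. card (bad_messages (\<epsilon> / 2) n (NB n) (NA n) cB cA x) < 3 * k"
        using ex_good_books[of "\<epsilon> / 2" n "NA n" "NB n" k, where 'x='x and 'y='y, unfolded \<gamma>'] True \<epsilon>(1)
        unfolding good_def by force
      let ?c = "cand_code W \<epsilon> n (NA n) (NB n) cA cB"
      have "adversary_identifying_code (NA n) (NB n) n ?c"
        using g N1 w by (intro adversary_identifying_cand_code) auto
      moreover have "Pe W (NA n) (NB n) n ?c \<le> dA n + dB n"
      proof (rule Pe_cand_code_le[OF N1 w])
        show "m1 = m2" if "m1 \<in> cand W \<epsilon> n (NA n) (NB n) cA cB z" "m2 \<in> cand W \<epsilon> n (NA n) (NB n) cA cB z"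
          "b \<in> cand (swap_mac W) \<epsilon> n (NB n) (NA n) cB cA z" for m1 m2 b z
          using sepA[OF _ \<epsilon>(2) g(1,3) that] \<epsilon> by simp
        show "m1 = m2" if "m1 \<in> cand (swap_mac W) \<epsilon> n (NB n) (NA n) cB cA z" "m2 \<in> cand (swap_mac W) \<epsilon> n (NB n) (NA n) cB cA z"
          "b \<in> cand W \<epsilon> n (NA n) (NB n) cA cB z" for m1 m2 b z
          using sepB[OF _ \<epsilon>(3) g(1,2) that(1,2)] that(3) \<epsilon> by simp
        fix y :: "nat \<Rightarrow> 'y" assume y: "y \<in> words n"
        show "1 / real (NA n) * (\<Sum>m\<in>{1..NA n}. measure_pmf.prob (product_channel W n (cA m) y)
            {z. m \<notin> cand W \<epsilon> n (NA n) (NB n) cA cB z}) \<le> dA n"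
          using avg_prob_not_cand_le[OF \<epsilon>(1) y N1(1) bad(1)[rule_format, OF y], of W]
          by (simp add: dA_def \<gamma>_def)
      next
        fix x :: "nat \<Rightarrow> 'x" assume x: "x \<in> words n"
        show "1 / real (NB n) * (\<Sum>m\<in>{1..NB n}. measure_pmf.prob (product_channel W n x (cB m))
            {z. m \<notin> cand (swap_mac W) \<epsilon> n (NB n) (NA n) cB cA z}) \<le> dB n"
          using avg_prob_not_cand_le[OF \<epsilon>(1) x N1(2) bad(2)[rule_format, OF x], of "swap_mac W"]
          by (simp add: dB_def \<gamma>_def)
      qed
      ultimately show ?thesis by blast
    qed
    then obtain c :: "nat \<Rightarrow> ('x, 'y, 'z) code" where
      c: "\<And>n. n \<ge> 1 \<Longrightarrow> adversary_identifying_code (NA n) (NB n) n (c n)"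
      "\<And>n. n \<ge> 1 \<Longrightarrow> good n \<Longrightarrow> Pe W (NA n) (NB n) n (c n) \<le> dA n + dB n"
      by metis
    have "(\<lambda>n. Pe W (NA n) (NB n) n (c n)) \<longlonglongrightarrow> 0"
    proof (rule tendsto_sandwich[of "\<lambda>_. 0"])
      show "eventually (\<lambda>n. Pe W (NA n) (NB n) n (c n) \<le> dA n + dB n) sequentially"
        using \<open>eventually good sequentially\<close> c(2) by (rule eventually_mono) (auto simp: good_def)
      show "(\<lambda>n. dA n + dB n) \<longlonglongrightarrow> 0" using tendsto_add[OF dA dB] by simp
    qed (auto simp: Pe_nonneg)
    then show "achievable W (RA, RB)"
      unfolding achievable_def NA_def NB_def using R c(1)[unfolded NA_def NB_def] by auto
  qed
qed

theorem theorem1: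
  fixes W :: "('x::finite, 'y::finite, 'z::finite) mac"
  shows "(A_spoofable W \<longrightarrow>
            (\<forall>NA NB n (c :: ('x, 'y, 'z) code).
               adversary_identifying_code NA NB n c \<and> NA \<ge> 2 \<longrightarrow> Pe W NA NB n c \<ge> 1 / 12)) \<and>
         (B_spoofable W \<longrightarrow>
            (\<forall>NA NB n (c :: ('x, 'y, 'z) code).
               adversary_identifying_code NA NB n c \<and> NB \<ge> 2 \<longrightarrow> Pe W NA NB n c \<ge> 1 / 12)) \<and>
         (\<not> A_spoofable W \<and> \<not> B_spoofable W \<longrightarrow> interior (capacity_region W) \<noteq> {})"
proof (intro conjI impI allI)
  fix NA NB n and c :: "('x, 'y, 'z) code"
  assume "A_spoofable W" "adversary_identifying_code NA NB n c \<and> NA \<ge> 2"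
  then show "Pe W NA NB n c \<ge> 1 / 12" using A_spoofable_imp_Pe_ge[of W NA NB n c] by simp
next
  fix NA NB n and c :: "('x, 'y, 'z) code"
  assume "B_spoofable W" "adversary_identifying_code NA NB n c \<and> NB \<ge> 2"
  then show "Pe W NA NB n c \<ge> 1 / 12" using B_spoofable_imp_Pe_ge[of W NA NB n c] by simp
next
  assume "\<not> A_spoofable W \<and> \<not> B_spoofable W"
  then obtain \<delta> where \<delta>: "\<delta> > 0" "\<And>RA RB. \<lbrakk>0 < RA; RA < \<delta>; 0 < RB; RB < \<delta>\<rbrakk> \<Longrightarrow> achievable W (RA, RB)"
    using achievable_small_rates by blast
  \<comment> \<open>The square avoids the axes: rate 0 means a single message, over which no bad
    message can be averaged away.\<close>
  have "{0<..<\<delta>} \<times> {0<..<\<delta>} \<subseteq> interior (capacity_region W)"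
  proof (rule interior_maximal)
    show "{0<..<\<delta>} \<times> {0<..<\<delta>} \<subseteq> capacity_region W"
      unfolding capacity_region_def using \<delta>(2) closure_subset by fastforce
  qed (simp add: open_Times)
  moreover have "(\<delta> / 2, \<delta> / 2) \<in> {0<..<\<delta>} \<times> {0<..<\<delta>}" using \<delta>(1) by simp
  ultimately show "interior (capacity_region W) \<noteq> {}" by blast
qed

end
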